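(* Let $(\Omega,\mathcal{A},\nu)$ be a measure space with $\nu:\mathcal{A}\to\mathbb{R}^+_0$ countably additive, and let $X$ be a Banach space. Let $\Phi:\Omega\to X$ be a strongly measurable function and $\mathcal{F}$ a sub-$\sigma$-algebra of $\mathcal{A}$ such that $\Phi$ has a conditional expectation $\mathbb{E}(\Phi|\mathcal{F})$. Then, for every $\mathcal{F}$-measurable function $\phi:\Omega\to\mathbb{R}$ such that $\Phi(\cdot)\phi(\cdot)\in Bi_1(\Omega,\nu)$, $$\mathbb{E}(\Phi(\omega)\phi(\omega)|\mathcal{F})=\phi(\omega)\,\mathbb{E}(\Phi|\mathcal{F}).$$
   Context: A partition of $\Omega$ is a finite or countable family of non-empty, pairwise disjoint measurable sets covering $\Omega$; $P$ is finer than $P'$ if every $U\in P$ is contained in some $U'\in P'$. First type Birkhoff integral: $\Phi:\Omega\to X$ is in $Bi_1(\Omega,\nu)$ if there is $\mathcal{I}\in X$ such that for all $\varepsilon>0$ there is a partition $P_\varepsilon$ of $\Omega$ such that for every countable partition $(U_n)_n$ of $\Omega$ finer than $P_\varepsilon$ and all $\omega_n\in U_n$, $\limsup_n\|\sum_{k=1}^n\Phi(\omega_k)\nu(U_k)-\mathcal{I}\|<\varepsilon$ (finite partitions are allowed, the sums then being finite); $\mathcal{I}=(Bi_1)\int_\Omega\Phi\,d\nu$. Integrals over $A\in\mathcal{A}$ are defined by restricting to $A$. Conditional expectation: for $\Phi\in Bi_1(\Omega,\nu)$ and a sub-$\sigma$-algebra $\mathcal{F}$ of $\mathcal{A}$,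 the conditional expectation $\mathbb{E}(\Phi|\mathcal{F})$, provided it exists, is the strongly $\mathcal{F}$-measurable function $\Psi\in Bi_1(\Omega,\nu)$ such that $(Bi_1)\int_E\Phi\,d\nu=(Bi_1)\int_E\Psi\,d\nu$ for every $E\in\mathcal{F}$ (understood up to $\nu$-null sets). Strongly $\mathcal{F}$-measurable means strongly measurable as a function from $(\Omega,\mathcal{F})$ to $(X,\mathcal{B}(X))$. *)

theory Defs
  imports "HOL-Probability.Probability"
begin

text \<open>
  Partitions are countable families of non-empty sets. The coarse partition is a set of sets; the
  finer one is an enumeration \<open>U\<close> indexed by \<open>I\<close>, where \<open>I\<close> is an initial segment
  of \<open>nat\<close> (finite partition) or all of \<open>nat\<close> (infinite partition).
\<close>

definition measurable_partition :: "'a measure \<Rightarrow> 'a set set \<Rightarrow> bool" where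
  "measurable_partition M P \<longleftrightarrow> countable P \<and> P \<subseteq> sets M \<and> partition_on (space M) P"

definition partition_enum :: "'a measure \<Rightarrow> nat set \<Rightarrow> (nat \<Rightarrow> 'a set) \<Rightarrow> bool" where
  "partition_enum M I U \<longleftrightarrow>
     (I = UNIV \<or> (\<exists>N. I = {..<N})) \<and> inj_on U I \<and> measurable_partition M (U ` I)"

text \<open>
  If \<open>I = {..<N}\<close>, the sequence below is constant from index \<open>N\<close> on, so its upper
  limit is the distance of the full finite sum from \<open>J\<close>.
\<close>

definition has_Bi1_integral ::
    "'a measure \<Rightarrow> ('a \<Rightarrow> 'x::banach) \<Rightarrow> 'x \<Rightarrow> bool" where
  "has_Bi1_integral M f J \<longleftrightarrow>
     (\<forall>\<epsilon>>0. \<exists>P. measurable_partition M P \<and>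
        (\<forall>I U \<omega>. partition_enum M I U \<and> refines (space M) (U ` I) P \<and> (\<forall>k\<in>I. \<omega> k \<in> U k) \<longrightarrow>
           limsup (\<lambda>n. ereal (norm ((\<Sum>k\<in>{..<n} \<inter> I. measure M (U k) *\<^sub>R f (\<omega> k)) - J)))
             < ereal \<epsilon>))"

definition Bi1 :: "'a measure \<Rightarrow> ('a \<Rightarrow> 'x::banach) set" where
  "Bi1 M = {f. \<exists>J. has_Bi1_integral M f J}"

definition has_Bi1_integral_on ::
    "'a measure \<Rightarrow> 'a set \<Rightarrow> ('a \<Rightarrow> 'x::banach) \<Rightarrow> 'x \<Rightarrow> bool" where
  "has_Bi1_integral_on M A f J \<longleftrightarrow> has_Bi1_integral (restrict_space M A) f J"

text \<open>
  Strong measurability is a property relative to a measurable space: the function is an everywhere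
  pointwise limit of simple functions (equivalently, Borel measurable with separable range). The
  values of the measure play no role.
\<close>

definition strongly_measurable :: "'a measure \<Rightarrow> ('a \<Rightarrow> 'x::banach) \<Rightarrow> bool" where
  "strongly_measurable M f \<longleftrightarrow>
     (\<exists>s. (\<forall>n. simple_function M (s n)) \<and> (\<forall>\<omega>\<in>space M. (\<lambda>n::nat. s n \<omega>) \<longlonglongrightarrow> f \<omega>))"

text \<open>
  A conditional expectation is determined only up to null sets, so we use the predicate
  ``\<open>\<Psi>\<close> is a version of the conditional expectation of \<open>\<Phi>\<close>''. The measure is always that
  of \<open>M\<close>; only the measurable sets of \<open>F\<close> are used.
\<close>

definition is_cond_exp ::
    "'a measure \<Rightarrow> 'a measure \<Rightarrow> ('a \<Rightarrow> 'x::banach) \<Rightarrow> ('a \<Rightarrow> 'x) \<Rightarrow> bool" where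
  "is_cond_exp M F \<Phi> \<Psi> \<longleftrightarrow>
     \<Phi> \<in> Bi1 M \<and> strongly_measurable F \<Psi> \<and> \<Psi> \<in> Bi1 M \<and>
     (\<forall>E\<in>sets F. \<exists>J. has_Bi1_integral_on M E \<Phi> J \<and> has_Bi1_integral_on M E \<Psi> J)"

end

theory Submission
  imports Defs
begin

text \<open>
  Let \<open>\<Psi>\<close> be a version of the conditional expectation of \<open>\<Phi>\<close>. If the multiplier \<open>\<phi>\<close> is simple, the
  claim is linearity of the integral, and a bounded \<open>\<phi>\<close> is a uniform limit of simple functions. The substance
  lies in the unbounded case: the integrability of \<open>\<phi> * \<Phi>\<close> is given, that of \<open>\<phi> * \<Psi>\<close> must be proved,
  and norms of integrals give no absolute convergence in a Banach space.

  The proof rests on a seminorm (\<open>birkhoff_bound\<close>): \<open>h\<close> has seminorm at most \<open>c\<close> if, for some countable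
  measurable partition, all sums of \<open>h\<close> over finite tagged families finer than it have norm at most \<open>c\<close>.
  A function has Birkhoff integral \<open>J\<close> exactly if it is approximated in this seminorm by simple
  functions whose integrals approximate \<open>J\<close> (\<open>has_Bi1_integral_imp_simple_approximation\<close> and
  \<open>has_Bi1_integralI_simple_approximation\<close>). Two facts make the passage from enumerated infinite
  partitions to finite families work: control over all enumerations yields control along the net of finite
  subsets, and subdividing a cell replaces its term by a convex combination of terms. Linearity,
  completeness, uniqueness and bounded multipliers follow by approximation.

  For unbounded \<open>\<phi>\<close>, let \<open>A n\<close> be the set where \<open>\<bar>\<phi>\<bar>\<close> is at least \<open>n\<close>. Off \<open>A n\<close> the multiplier is bounded.
  On \<open>A n\<close> the function \<open>\<phi> * \<Phi>\<close> has small seminorm for large \<open>n\<close>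
  (\<open>Bi1_absolutely_continuous\<close>), and this passes to \<open>\<phi> * \<Psi>\<close> (\<open>birkhoff_bound_transfer\<close>): since \<open>\<phi> * \<Psi>\<close> is
  strongly measurable for \<open>F\<close>, its sum over a fine tagged family is nearly the integral of \<open>c * \<phi> * \<Psi>\<close> for
  a weight \<open>c\<close> with values between \<open>0\<close> and \<open>1\<close> that is measurable for \<open>F\<close> and on whose support \<open>\<phi>\<close> is
  bounded. That integral equals the one of \<open>c * \<phi> * \<Phi>\<close>, which is small. Hence \<open>\<phi> * \<Psi>\<close> is
  a limit of its truncations, whose integrals converge to that of \<open>\<phi> * \<Phi>\<close>. Replacing \<open>\<phi>\<close> by its product with the
  indicator of a set of \<open>F\<close> gives the identity over that set.

  Uniqueness up to null sets holds because a strongly measurable function is nearly constant on the cells of a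
  countable partition, so that vanishing integrals over the cells force it to be small on every cell of
  positive measure.
\<close>

section \<open>Rearrangements and convex combinations\<close>

text \<open>
  If the property failed along the finite subsets of \<open>Q\<close>, every finite subset would have a finite
  superset violating it. Chaining such supersets, and inserting the \<open>n\<close>-th element of \<open>Q\<close>
  at stage \<open>n\<close>, gives an enumeration of \<open>Q\<close> that has infinitely many violating initial segments.
  The integral speaks of enumerated partitions; this removes the enumeration.
\<close>

lemma eventually_finite_subsets_if_rearrangements:
  assumes "countable Q" "infinite Q"
    and rearr: "\<And>U. bij_betw U (UNIV :: nat set) Q \<Longrightarrow> \<forall>\<^sub>F n in sequentially. P (U ` {..<n})"
  shows "\<forall>\<^sub>F F in finite_subsets_at_top Q. P F"
proof (rule ccontr)
  assume "\<not> ?thesis"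
  then have bad: "\<exists>F'. finite F' \<and> F \<subseteq> F' \<and> F' \<subseteq> Q \<and> \<not> P F'" if "finite F" "F \<subseteq> Q" for F
    using that by (auto simp: eventually_finite_subsets_at_top)
  let ?e = "from_nat_into Q"
  have e: "range ?e = Q"
    using assms by (simp add: bij_betw_from_nat_into bij_betw_imp_surj_on)
  have "\<exists>L. \<forall>n. (distinct (L n) \<and> set (L n) \<subseteq> Q) \<and>
      (\<exists>ys. ys \<noteq> [] \<and> L (Suc n) = L n @ ys \<and> ?e n \<in> set (L (Suc n)) \<and> \<not> P (set (L (Suc n))))"
  proof (rule dependent_nat_choice)
    show "\<exists>x. distinct x \<and> set x \<subseteq> Q" by (rule exI[of _ "[]"]) simp
  next
    fix xs n assume xs: "distinct xs \<and> set xs \<subseteq> Q"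
    obtain z where z: "z \<in> Q" "z \<notin> set xs"
      using \<open>infinite Q\<close> finite_subset[of Q "set xs"] by auto
    obtain F where F: "finite F" "insert z (insert (?e n) (set xs)) \<subseteq> F" "F \<subseteq> Q" "\<not> P F"
      using bad[of "insert z (insert (?e n) (set xs))"] xs z e by (auto simp: image_subset_iff)
    obtain ys where ys: "set ys = F - set xs" "distinct ys"
      using finite_distinct_list[of "F - set xs"] F by auto
    have "ys \<noteq> []" using ys z F by force
    moreover have "set (xs @ ys) = F" using ys F by auto
    ultimately show "\<exists>y. (distinct y \<and> set y \<subseteq> Q) \<and>
        (\<exists>ys. ys \<noteq> [] \<and> y = xs @ ys \<and> ?e n \<in> set y \<and> \<not> P (set y))"
      using ys F xs by (intro exI[of _ "xs @ ys"] conjI exI[of _ ys]) auto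
  qed
  then obtain L where L: "\<forall>n. (distinct (L n) \<and> set (L n) \<subseteq> Q) \<and>
      (\<exists>ys. ys \<noteq> [] \<and> L (Suc n) = L n @ ys \<and> ?e n \<in> set (L (Suc n)) \<and> \<not> P (set (L (Suc n))))"
    by (rule exE)
  have dist: "distinct (L n)" and sub: "set (L n) \<subseteq> Q" for n
    using spec[OF L, of n] by simp_all
  have step: "\<exists>ys. ys \<noteq> [] \<and> L (Suc n) = L n @ ys" for n
    using spec[OF L, of n] by (elim conjE exE) (intro exI conjI)
  have hit: "?e n \<in> set (L (Suc n))" for n
    using spec[OF L, of n] by (elim conjE exE)
  have nP: "\<not> P (set (L (Suc n)))" for n
    using spec[OF L, of n] by (elim conjE exE)
  have len: "n \<le> length (L n)" for n
  proof (induction n)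
    case (Suc n)
    obtain ys where "ys \<noteq> []" "L (Suc n) = L n @ ys" using step by blast
    then show ?case using Suc by (cases ys) auto
  qed simp
  have pre: "\<exists>zs. L (m + k) = L m @ zs" for m k
  proof (induction k)
    case (Suc k) then show ?case using step[of "m + k"] by auto
  qed auto
  define U where "U k = L (Suc k) ! k" for k
  have U: "U k = L m ! k" if "k < length (L m)" for k m
  proof (cases "m \<le> Suc k")
    case True
    then obtain zs where "L (Suc k) = L m @ zs" using pre[of m "Suc k - m"] by auto
    then show ?thesis using that by (simp add: U_def nth_append)
  next
    case False
    then obtain zs where "L m = L (Suc k) @ zs" using pre[of "Suc k" "m - Suc k"] by auto
    moreover have "k < length (L (Suc k))" using len[of "Suc k"] by simp
    ultimately show ?thesis by (simp add: U_def nth_append)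
  qed
  have img: "U ` {..<length (L m)} = set (L m)" for m
    using U[of _ m] by (force simp: set_conv_nth image_iff)
  have "bij_betw U UNIV Q"
  proof (rule bij_betw_imageI)
    show "inj U"
    proof (rule injI)
      fix i j assume eq: "U i = U j"
      let ?m = "Suc (max i j)"
      have "i < length (L ?m)" "j < length (L ?m)" using len[of ?m] by auto
      then show "i = j" using eq U[of i ?m] U[of j ?m] dist[of ?m] nth_eq_iff_index_eq by metis
    qed
    show "range U = Q"
    proof
      show "range U \<subseteq> Q"
      proof safe
        fix k have "k < length (L (Suc k))" using len[of "Suc k"] by simp
        then show "U k \<in> Q" using sub[of "Suc k"] by (auto simp: U_def)
      qed
      show "Q \<subseteq> range U"
      proof
        fix x assume "x \<in> Q"
        then obtain n where "x = ?e n" using e by (metis rangeE)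
        then have "x \<in> U ` {..<length (L (Suc n))}" using hit img by metis
        then show "x \<in> range U" by auto
      qed
    qed
  qed
  from rearr[OF this] obtain N where "\<And>n. n \<ge> N \<Longrightarrow> P (U ` {..<n})"
    by (auto simp: eventually_sequentially)
  then have "P (U ` {..<length (L (Suc N))})" using Suc_leD[OF len[of "Suc N"]] by simp
  then have "P (set (L (Suc N)))" by (simp only: img)
  with nP[of N] show False by (rule notE)
qed

text \<open>
  Every summand may be moved into the convex hull independently of the others, since a ball is
  convex. This is used in two ways: to put weights on the terms of a sum whose subsums are controlled, and
  to subdivide the cells of a partition, where the tags of the pieces of a cell are averaged.
\<close>

lemma norm_sum_convex_hull_le:
  fixes z :: "'i \<Rightarrow> 'b::real_normed_vector"
  assumes "finite G"
    and "\<And>y. (\<And>V. V \<in> G \<Longrightarrow> y V \<in> K V) \<Longrightarrow> norm (sum y G) \<le> c"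
    and "\<And>V. V \<in> G \<Longrightarrow> z V \<in> convex hull (K V)"
  shows "norm (sum z G) \<le> c"
proof -
  have "norm (a + sum z G) \<le> c"
    if "\<And>y. (\<And>V. V \<in> G \<Longrightarrow> y V \<in> K V) \<Longrightarrow> norm (a + sum y G) \<le> c" for a
    using assms(1,3) that
  proof (induction G arbitrary: a rule: finite_induct)
    case empty
    then show ?case by simp
  next
    case (insert W G)
    have hull: "convex hull (K W) \<subseteq> {w. norm (a + w + sum z G) \<le> c}"
    proof (rule hull_minimal)
      show "K W \<subseteq> {w. norm (a + w + sum z G) \<le> c}"
      proof safe
        fix w assume w: "w \<in> K W"
        show "norm (a + w + sum z G) \<le> c"
        proof (rule insert.IH)
          fix y assume y: "\<And>V. V \<in> G \<Longrightarrow> y V \<in> K V"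
          have "norm (a + sum (y(W := w)) (insert W G)) \<le> c"
            by (rule insert.prems(2)) (use y w in auto)
          moreover have "sum (y(W := w)) G = sum y G"
            using insert.hyps by (intro sum.cong) auto
          ultimately show "norm (a + w + sum y G) \<le> c"
            using insert.hyps by (simp add: add.assoc)
        qed (use insert.prems(1) in simp)
      qed
      have "{w. norm (a + w + sum z G) \<le> c} = cball (- (a + sum z G)) c"
      proof (rule set_eqI)
        fix w
        have "dist (- (a + sum z G)) w = norm (- (a + w + sum z G))"
          unfolding dist_norm by (rule arg_cong[of _ _ norm]) (simp add: algebra_simps)
        then show "w \<in> {w. norm (a + w + sum z G) \<le> c} \<longleftrightarrow> w \<in> cball (- (a + sum z G)) c"
          by (simp only: norm_minus_cancel mem_cball mem_Collect_eq)
      qed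
      then show "convex {w. norm (a + w + sum z G) \<le> c}"
        by simp
    qed
    have "z W \<in> convex hull (K W)" using insert.prems(1) by simp
    with hull have "norm (a + z W + sum z G) \<le> c" by (simp only: subset_iff mem_Collect_eq)
    then show ?case using insert.hyps by (simp add: add.assoc)
  qed
  from this[of 0] assms(2) show ?thesis by simp
qed

text \<open>
  Every enumeration of \<open>P\<close> is itself a partition finer than \<open>P\<close>, so the upper limits in the
  definition of the integral control all rearrangements of a tagged sum.
\<close>

lemma has_Bi1_integral_eventually:
  fixes f :: "'a \<Rightarrow> 'x::banach"
  assumes "has_Bi1_integral M f J" "0 < \<epsilon>"
  obtains P where "measurable_partition M P"
    and "\<forall>\<omega>. (\<forall>V\<in>P. \<omega> V \<in> V) \<longrightarrow>
      (\<forall>\<^sub>F G in finite_subsets_at_top P. norm ((\<Sum>V\<in>G. measure M V *\<^sub>R f (\<omega> V)) - J) < \<epsilon>)"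
proof -
  obtain P where P: "measurable_partition M P"
    and "\<forall>I U \<omega>. partition_enum M I U \<and> refines (space M) (U ` I) P \<and> (\<forall>k\<in>I. \<omega> k \<in> U k) \<longrightarrow>
           limsup (\<lambda>n. ereal (norm ((\<Sum>k\<in>{..<n} \<inter> I. measure M (U k) *\<^sub>R f (\<omega> k)) - J))) < ereal \<epsilon>"
    using assms(1)[unfolded has_Bi1_integral_def, rule_format, OF assms(2)] by (elim exE conjE)
  note lim = this(2)[rule_format]
  have ref: "refines (space M) P P"
    using P by (auto simp: refines_def measurable_partition_def)
  show ?thesis
  proof (rule that[OF P], intro allI impI)
    fix \<omega> assume \<omega>: "\<forall>V\<in>P. \<omega> V \<in> V"
    have ev: "\<forall>\<^sub>F n in sequentially. norm ((\<Sum>V\<in>U ` ({..<n} \<inter> I). measure M V *\<^sub>R f (\<omega> V)) - J) < \<epsilon>"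
      if "bij_betw U I P" "I = UNIV \<or> (\<exists>N. I = {..<N})" for U :: "nat \<Rightarrow> 'a set" and I
    proof -
      have U: "U ` I = P" "inj_on U I" using that by (auto simp: bij_betw_def)
      have "limsup (\<lambda>n. ereal (norm ((\<Sum>k\<in>{..<n} \<inter> I. measure M (U k) *\<^sub>R f (\<omega> (U k))) - J))) < ereal \<epsilon>"
        using U P ref that(2) \<omega> by (intro lim) (auto simp: partition_enum_def)
      from Limsup_lessD[OF this] show ?thesis
      proof eventually_elim
        case (elim n)
        have "inj_on U ({..<n} \<inter> I)" using U(2) by (rule inj_on_subset) auto
        then show ?case using elim by (simp add: sum.reindex)
      qed
    qed
    show "\<forall>\<^sub>F G in finite_subsets_at_top P. norm ((\<Sum>V\<in>G. measure M V *\<^sub>R f (\<omega> V)) - J) < \<epsilon>"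
    proof (cases "finite P")
      case True
      then obtain U where U: "bij_betw U {..<card P} P"
        using ex_bij_betw_nat_finite[of P] by (auto simp: atLeast0LessThan)
      then obtain n where "card P \<le> n"
        "norm ((\<Sum>V\<in>U ` ({..<n} \<inter> {..<card P}). measure M V *\<^sub>R f (\<omega> V)) - J) < \<epsilon>"
        using ev[OF U] unfolding eventually_sequentially by (metis nle_le)
      moreover have "U ` ({..<n} \<inter> {..<card P}) = P"
        using U \<open>card P \<le> n\<close> by (simp add: bij_betw_def Int_absorb1)
      ultimately have "norm ((\<Sum>V\<in>P. measure M V *\<^sub>R f (\<omega> V)) - J) < \<epsilon>" by simp
      then show ?thesis using True by (auto simp: eventually_finite_subsets_at_top intro!: exI[of _ P])
    next
      case False
      then show ?thesis
        using P ev[of _ UNIV]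
        by (intro eventually_finite_subsets_if_rearrangements) (auto simp: measurable_partition_def)
    qed
  qed
qed

section \<open>The Birkhoff seminorm\<close>

lemma measurable_partition_index:
  assumes "measurable_partition M P"
  obtains p :: "'a \<Rightarrow> nat" where "p \<in> measurable M (count_space UNIV)"
    and "\<And>x y V. x \<in> space M \<Longrightarrow> V \<in> P \<Longrightarrow> y \<in> V \<Longrightarrow> p x = p y \<Longrightarrow> x \<in> V"
proof -
  have P: "countable P" "P \<subseteq> sets M" "\<Union>P = space M" "disjoint P"
    using assms by (auto simp: measurable_partition_def partition_on_def)
  define c where "c x = (THE V. V \<in> P \<and> x \<in> V)" for x
  have c_eq: "c x = V" if "V \<in> P" "x \<in> V" for x V
    unfolding c_def using that P(4) by (intro the_equality) (auto simp: disjoint_def)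
  have c_mem: "c x \<in> P" "x \<in> c x" if "x \<in> space M" for x
    using that P(3) c_eq by auto
  define p where "p x = to_nat_on P (c x)" for x
  have "p -` {i} \<inter> space M \<in> sets M" for i
  proof (cases "\<exists>V\<in>P. to_nat_on P V = i")
    case True
    then obtain V where V: "V \<in> P" "to_nat_on P V = i" by blast
    have "x \<in> V" if "x \<in> space M" "p x = i" for x
      using that V P(1) c_mem[of x] inj_on_to_nat_on[OF P(1)] by (auto simp: p_def inj_on_def)
    moreover have "p x = i" "x \<in> space M" if "x \<in> V" for x
      using that V c_eq[of V x] P(3) by (auto simp: p_def)
    ultimately have "p -` {i} \<inter> space M = V" by auto
    then show ?thesis using V P(2) by auto
  next
    case False
    then have "p -` {i} \<inter> space M = {}" using c_mem by (auto simp: p_def)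
    then show ?thesis by simp
  qed
  then have "p \<in> measurable M (count_space UNIV)"
    by (simp add: measurable_count_space_eq2_countable)
  moreover have "x \<in> V" if "x \<in> space M" "V \<in> P" "y \<in> V" "p x = p y" for x y V
  proof -
    have "c y = V" using c_eq that by blast
    then have "c x = V" using that c_mem[of x] inj_on_to_nat_on[OF P(1)] by (auto simp: p_def inj_on_def)
    then show ?thesis using c_mem[of x] that by simp
  qed
  ultimately show ?thesis by (rule that)
qed

text \<open>
  Partitions are given by a function \<open>p\<close> with values in the natural numbers, the cells being its
  fibres: a common refinement is then a pairing of two such functions. A tagged family is a finite piece
  of a tagged partition finer than the fibres of \<open>p\<close>.
\<close>

definition tagged_family :: "'a measure \<Rightarrow> ('a \<Rightarrow> nat) \<Rightarrow> 'a set set \<Rightarrow> ('a set \<Rightarrow> 'a) \<Rightarrow> bool" where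
  "tagged_family M p \<U> \<omega> \<longleftrightarrow>
     finite \<U> \<and> \<U> \<subseteq> sets M \<and> disjoint \<U> \<and> (\<forall>U\<in>\<U>. \<omega> U \<in> U \<and> (\<forall>x\<in>U. p x = p (\<omega> U)))"

definition birkhoff_bound_along :: "'a measure \<Rightarrow> ('a \<Rightarrow> nat) \<Rightarrow> real \<Rightarrow> ('a \<Rightarrow> 'x::banach) \<Rightarrow> bool" where
  "birkhoff_bound_along M p c h \<longleftrightarrow>
     (\<forall>\<U> \<omega>. tagged_family M p \<U> \<omega> \<longrightarrow> norm (\<Sum>U\<in>\<U>. measure M U *\<^sub>R h (\<omega> U)) \<le> c)"

text \<open>
  The infimum of all such \<open>c\<close> is a seminorm of \<open>h\<close>. It plays the role that the Pettis norm, the supremum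
  of the norms of the integrals over measurable sets, plays for integrable functions, but it is also
  meaningful for functions that are not known to be integrable.
\<close>

definition birkhoff_bound :: "'a measure \<Rightarrow> real \<Rightarrow> ('a \<Rightarrow> 'x::banach) \<Rightarrow> bool" where
  "birkhoff_bound M c h \<longleftrightarrow>
     (\<exists>p\<in>measurable M (count_space (UNIV :: nat set)). birkhoff_bound_along M p c h)"

lemma birkhoff_bound_alongD:
  "birkhoff_bound_along M p c h \<Longrightarrow> tagged_family M p \<U> \<omega> \<Longrightarrow>
    norm (\<Sum>U\<in>\<U>. measure M U *\<^sub>R h (\<omega> U)) \<le> c"
  by (simp add: birkhoff_bound_along_def)

lemma birkhoff_boundI:
  assumes "p \<in> measurable M (count_space (UNIV :: nat set))"
    and "\<And>\<U> \<omega>. tagged_family M p \<U> \<omega> \<Longrightarrow> norm (\<Sum>U\<in>\<U>. measure M U *\<^sub>R h (\<omega> U)) \<le> c"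
  shows "birkhoff_bound M c h"
  unfolding birkhoff_bound_def birkhoff_bound_along_def
  by (intro bexI[OF _ assms(1)] allI impI) (rule assms(2))

lemma tagged_family_const:
  assumes "tagged_family M p \<U> \<omega>" "U \<in> \<U>" "x \<in> U"
  shows "p x = p (\<omega> U)"
  using assms unfolding tagged_family_def by blast

lemma tagged_family_tag_in_space:
  assumes "tagged_family M p \<U> \<omega>" "U \<in> \<U>"
  shows "\<omega> U \<in> space M"
proof -
  have "U \<in> sets M" "\<omega> U \<in> U" using assms unfolding tagged_family_def by blast+
  then show ?thesis using sets.sets_into_space by blast
qed

lemma tagged_family_subset:
  assumes "tagged_family M p \<U> \<omega>" "\<V> \<subseteq> \<U>"
  shows "tagged_family M p \<V> \<omega>"
proof -
  have "disjoint \<V>" using assms by (auto simp: tagged_family_def intro: pairwise_subset)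
  then show ?thesis
    using assms finite_subset[OF assms(2)] unfolding tagged_family_def by blast
qed

lemma birkhoff_bound_nonneg:
  assumes "birkhoff_bound M c h" shows "0 \<le> c"
proof -
  obtain p where p: "p \<in> measurable M (count_space (UNIV :: nat set))"
    "birkhoff_bound_along M p c h"
    using assms(1) unfolding birkhoff_bound_def by blast
  note p = p(1) birkhoff_bound_alongD[OF p(2)]
  have "tagged_family M p {} \<omega>" for \<omega> by (simp add: tagged_family_def)
  from p(2)[OF this] show ?thesis by simp
qed

lemma birkhoff_bound_mono:
  assumes "birkhoff_bound M c h" "c \<le> d"
  shows "birkhoff_bound M d h"
proof -
  obtain p where p: "p \<in> measurable M (count_space (UNIV :: nat set))"
    "birkhoff_bound_along M p c h"
    using assms(1) unfolding birkhoff_bound_def by blast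
  note p = p(1) birkhoff_bound_alongD[OF p(2)]
  show ?thesis
    by (rule birkhoff_boundI[OF p(1)]) (rule order_trans[OF p(2) \<open>c \<le> d\<close>])
qed

lemma birkhoff_bound_cong:
  assumes "birkhoff_bound M c h" "\<And>x. x \<in> space M \<Longrightarrow> h x = h' x"
  shows "birkhoff_bound M c h'"
proof -
  obtain p where p: "p \<in> measurable M (count_space (UNIV :: nat set))"
    "birkhoff_bound_along M p c h"
    using assms(1) unfolding birkhoff_bound_def by blast
  note p = p(1) birkhoff_bound_alongD[OF p(2)]
  show ?thesis
  proof (rule birkhoff_boundI[OF p(1)])
    fix \<U> \<omega> assume T: "tagged_family M p \<U> \<omega>"
    have "(\<Sum>U\<in>\<U>. measure M U *\<^sub>R h' (\<omega> U)) = (\<Sum>U\<in>\<U>. measure M U *\<^sub>R h (\<omega> U))"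
      using tagged_family_tag_in_space[OF T] assms(2) by (intro sum.cong) auto
    then show "norm (\<Sum>U\<in>\<U>. measure M U *\<^sub>R h' (\<omega> U)) \<le> c" using p(2)[OF T] by simp
  qed
qed

lemma birkhoff_bound_uminus: "birkhoff_bound M c h \<Longrightarrow> birkhoff_bound M c (\<lambda>x. - h x)"
  by (simp add: birkhoff_bound_def birkhoff_bound_along_def sum_negf)

lemma measurable_prod_encode:
  assumes "p \<in> measurable M (count_space (UNIV :: nat set))"
    and "q \<in> measurable M (count_space (UNIV :: nat set))"
  shows "(\<lambda>x. prod_encode (p x, q x)) \<in> measurable M (count_space UNIV)"
  using assms by measurable

lemma tagged_family_prod_encode:
  assumes "tagged_family M (\<lambda>x. prod_encode (p x, q x)) \<U> \<omega>"
  shows "tagged_family M p \<U> \<omega>" "tagged_family M q \<U> \<omega>"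
  using assms unfolding tagged_family_def prod_encode_eq prod.inject by blast+

lemma birkhoff_bound_add:
  assumes "birkhoff_bound M c f" "birkhoff_bound M d g"
  shows "birkhoff_bound M (c + d) (\<lambda>x. f x + g x)"
proof -
  obtain p where p: "p \<in> measurable M (count_space (UNIV :: nat set))"
    "birkhoff_bound_along M p c f"
    using assms(1) unfolding birkhoff_bound_def by blast
  note p = p(1) birkhoff_bound_alongD[OF p(2)]
  obtain q where q: "q \<in> measurable M (count_space (UNIV :: nat set))"
    "birkhoff_bound_along M q d g"
    using assms(2) unfolding birkhoff_bound_def by blast
  note q = q(1) birkhoff_bound_alongD[OF q(2)]
  show ?thesis
  proof (rule birkhoff_boundI[OF measurable_prod_encode[OF p(1) q(1)]])
    fix \<U> \<omega> assume *: "tagged_family M (\<lambda>x. prod_encode (p x, q x)) \<U> \<omega>"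
    show "norm (\<Sum>U\<in>\<U>. measure M U *\<^sub>R (f (\<omega> U) + g (\<omega> U))) \<le> c + d"
      using norm_triangle_mono[OF p(2)[OF tagged_family_prod_encode(1)[OF *]]
          q(2)[OF tagged_family_prod_encode(2)[OF *]]]
      by (simp add: scaleR_add_right sum.distrib)
  qed
qed

lemma birkhoff_bound_diff:
  assumes "birkhoff_bound M c f" "birkhoff_bound M d g"
  shows "birkhoff_bound M (c + d) (\<lambda>x. f x - g x)"
  using birkhoff_bound_add[OF assms(1) birkhoff_bound_uminus[OF assms(2)]] by simp

text \<open>
  Only the values of \<open>a\<close> at the tags enter, so \<open>a\<close> may be any bounded function. With signs as weights the
  sum is a difference of two subsums, each bounded by \<open>c\<close>; weights in between are convex combinations.
\<close>

lemma birkhoff_bound_mult: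
  assumes "birkhoff_bound M c f" "0 \<le> K" and a: "\<And>x. x \<in> space M \<Longrightarrow> \<bar>a x\<bar> \<le> K"
  shows "birkhoff_bound M (2 * K * c) (\<lambda>x. a x *\<^sub>R f x)"
proof -
  obtain p where p: "p \<in> measurable M (count_space (UNIV :: nat set))"
    "birkhoff_bound_along M p c f"
    using assms(1) unfolding birkhoff_bound_def by blast
  note p = p(1) birkhoff_bound_alongD[OF p(2)]
  show ?thesis
  proof (rule birkhoff_boundI[OF p(1)])
    fix \<U> \<omega> assume T: "tagged_family M p \<U> \<omega>"
    define w where "w U = measure M U *\<^sub>R f (\<omega> U)" for U
    have fin: "finite \<U>" using T by (simp add: tagged_family_def)
    have w: "norm (sum w \<V>) \<le> c" if "\<V> \<subseteq> \<U>" for \<V>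
      using p(2)[OF tagged_family_subset[OF T that]] by (simp add: w_def)
    have "norm (\<Sum>U\<in>\<U>. a (\<omega> U) *\<^sub>R w U) \<le> 2 * K * c"
    proof (rule norm_sum_convex_hull_le[OF fin, where K = "\<lambda>U. {K *\<^sub>R w U, - (K *\<^sub>R w U)}"])
      fix y assume y: "\<And>U. U \<in> \<U> \<Longrightarrow> y U \<in> {K *\<^sub>R w U, - (K *\<^sub>R w U)}"
      define \<P> where "\<P> = {U \<in> \<U>. y U = K *\<^sub>R w U}"
      have "sum y \<U> = sum y \<P> + sum y (\<U> - \<P>)"
        using fin by (subst sum.subset_diff[of \<P>]) (auto simp: \<P>_def)
      also have "sum y \<P> = K *\<^sub>R sum w \<P>"
        by (simp add: \<P>_def scaleR_sum_right)
      also have "sum y (\<U> - \<P>) = - (K *\<^sub>R sum w (\<U> - \<P>))"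
        unfolding scaleR_sum_right sum_negf[symmetric] using y by (intro sum.cong) (auto simp: \<P>_def)
      finally have eq: "sum y \<U> = K *\<^sub>R (sum w \<P> - sum w (\<U> - \<P>))"
        by (simp add: scaleR_diff_right)
      have "norm (sum w \<P> - sum w (\<U> - \<P>)) \<le> c + c"
        by (intro norm_triangle_le_diff add_mono w) (auto simp: \<P>_def)
      from mult_left_mono[OF this \<open>0 \<le> K\<close>] show "norm (sum y \<U>) \<le> 2 * K * c"
        using \<open>0 \<le> K\<close> by (simp add: eq mult.assoc mult.left_commute)
    next
      fix U assume U: "U \<in> \<U>"
      define t where "t = (if K = 0 then 1 / 2 else (a (\<omega> U) / K + 1) / 2)"
      have aU: "\<bar>a (\<omega> U)\<bar> \<le> K" using a tagged_family_tag_in_space[OF T U] by blast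
      have t: "0 \<le> t" "t \<le> 1" using aU \<open>0 \<le> K\<close> by (auto simp: t_def field_simps)
      have "a (\<omega> U) = t * K - (1 - t) * K" using aU by (cases "K = 0") (auto simp: t_def field_simps)
      then have "a (\<omega> U) *\<^sub>R w U = t *\<^sub>R (K *\<^sub>R w U) + (1 - t) *\<^sub>R (- (K *\<^sub>R w U))"
        by (simp add: scaleR_diff_left)
      then show "a (\<omega> U) *\<^sub>R w U \<in> convex hull {K *\<^sub>R w U, - (K *\<^sub>R w U)}"
        unfolding convex_hull_2 using t by (intro CollectI exI[of _ t] exI[of _ "1 - t"]) auto
    qed
    then show "norm (\<Sum>U\<in>\<U>. measure M U *\<^sub>R (a (\<omega> U) *\<^sub>R f (\<omega> U))) \<le> 2 * K * c"
      by (simp add: w_def mult.commute)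
  qed
qed

lemma birkhoff_bound_indicator:
  assumes "birkhoff_bound M c f"
  shows "birkhoff_bound M (2 * c) (\<lambda>x. indicator A x *\<^sub>R f x)"
  using birkhoff_bound_mult[OF assms, of 1 "indicator A"] by (simp add: indicator_def)

abbreviation simple_int :: "'a measure \<Rightarrow> ('a \<Rightarrow> 'b::real_vector) \<Rightarrow> 'b" where
  "simple_int \<equiv> Bochner_Integration.simple_bochner_integral"

context finite_measure
begin

text \<open>
  Refining by \<open>A\<close> makes each member of a tagged family lie inside \<open>A\<close> or outside of it.
\<close>

lemma birkhoff_bound_uniform:
  assumes "A \<in> sets M" "0 \<le> C"
    and h: "\<And>x. x \<in> A \<Longrightarrow> norm (h x) \<le> C" "\<And>x. x \<in> space M \<Longrightarrow> x \<notin> A \<Longrightarrow> h x = 0"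
  shows "birkhoff_bound M (C * measure M A) h"
proof (rule birkhoff_boundI[of "\<lambda>x. if x \<in> A then 1 else 0"])
  show "(\<lambda>x. if x \<in> A then 1 else 0) \<in> measurable M (count_space (UNIV :: nat set))"
    using \<open>A \<in> sets M\<close> by measurable
  fix \<U> \<omega> assume T: "tagged_family M (\<lambda>x. if x \<in> A then 1 else 0) \<U> \<omega>"
  then have fin: "finite \<U>" and "\<U> \<subseteq> sets M" "disjoint \<U>" by (auto simp: tagged_family_def)
  define \<V> where "\<V> = {U \<in> \<U>. \<omega> U \<in> A}"
  have sub: "\<Union>\<V> \<subseteq> A"
  proof safe
    fix x U assume "U \<in> \<V>" "x \<in> U"
    then have "(if x \<in> A then 1 else 0 :: nat) = (if \<omega> U \<in> A then 1 else 0)"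
      using T unfolding tagged_family_def \<V>_def by blast
    then show "x \<in> A" using \<open>U \<in> \<V>\<close> by (simp add: \<V>_def split: if_splits)
  qed
  have "(\<Sum>U\<in>\<U>. measure M U *\<^sub>R h (\<omega> U)) = (\<Sum>U\<in>\<V>. measure M U *\<^sub>R h (\<omega> U))"
    using fin h(2) tagged_family_tag_in_space[OF T]
    by (intro sum.mono_neutral_right) (auto simp: \<V>_def)
  also have "norm \<dots> \<le> (\<Sum>U\<in>\<V>. C * measure M U)"
  proof (rule sum_norm_le)
    fix U assume "U \<in> \<V>"
    then have "norm (h (\<omega> U)) \<le> C" using h(1) by (simp add: \<V>_def)
    then show "norm (measure M U *\<^sub>R h (\<omega> U)) \<le> C * measure M U"
      by (simp add: mult.commute[of C] mult_left_mono)
  qed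
  also have "\<dots> = C * measure M (\<Union>\<V>)"
    using fin \<open>\<U> \<subseteq> sets M\<close> \<open>disjoint \<U>\<close>
    by (subst measure_Union') (auto simp: \<V>_def sum_distrib_left fmeasurable_eq_sets pairwise_def disjnt_def disjoint_def)
  also have "\<dots> \<le> C * measure M A"
    using sub \<open>A \<in> sets M\<close> \<open>0 \<le> C\<close> by (intro mult_left_mono finite_measure_mono) auto
  finally show "norm (\<Sum>U\<in>\<U>. measure M U *\<^sub>R h (\<omega> U)) \<le> C * measure M A" .
qed

lemma sum_simple_function_over_family:
  fixes s :: "'a \<Rightarrow> 'x::banach"
  assumes "simple_function M s" and fin: "finite \<U>" and sets: "\<U> \<subseteq> sets M" and disj: "disjoint \<U>"
    and tag: "\<And>U. U \<in> \<U> \<Longrightarrow> \<omega> U \<in> U"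
    and const: "\<And>U x. U \<in> \<U> \<Longrightarrow> x \<in> U \<Longrightarrow> s x = s (\<omega> U)"
  shows "(\<Sum>U\<in>\<U>. measure M U *\<^sub>R s (\<omega> U)) =
    (\<Sum>y\<in>s ` space M. measure M ({x \<in> space M. s x = y} \<inter> \<Union>\<U>) *\<^sub>R y)"
proof -
  have fs: "finite (s ` space M)" using assms(1) by (simp add: simple_functionD)
  have tagsp: "\<omega> U \<in> space M" if "U \<in> \<U>" for U
    using that tag sets sets.sets_into_space by blast
  have "measure M ({x \<in> space M. s x = y} \<inter> \<Union>\<U>) = (\<Sum>U\<in>\<U>. if s (\<omega> U) = y then measure M U else 0)" for y
  proof -
    have "{x \<in> space M. s x = y} \<inter> \<Union>\<U> = \<Union>{U \<in> \<U>. s (\<omega> U) = y}"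
    proof (intro set_eqI iffI)
      fix x assume "x \<in> {x \<in> space M. s x = y} \<inter> \<Union>\<U>"
      then show "x \<in> \<Union>{U \<in> \<U>. s (\<omega> U) = y}" using const by auto
    next
      fix x assume "x \<in> \<Union>{U \<in> \<U>. s (\<omega> U) = y}"
      then obtain U where "U \<in> \<U>" "x \<in> U" "s (\<omega> U) = y" by auto
      then show "x \<in> {x \<in> space M. s x = y} \<inter> \<Union>\<U>"
        using const[of U x] sets sets.sets_into_space by auto
    qed
    also have "measure M \<dots> = (\<Sum>U\<in>{U \<in> \<U>. s (\<omega> U) = y}. measure M U)"
      using fin sets disj
      by (subst measure_Union') (auto simp: fmeasurable_eq_sets pairwise_def disjnt_def disjoint_def)
    finally show ?thesis using fin by (simp add: sum.inter_filter)
  qed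
  then have "(\<Sum>y\<in>s ` space M. measure M ({x \<in> space M. s x = y} \<inter> \<Union>\<U>) *\<^sub>R y) =
      (\<Sum>y\<in>s ` space M. \<Sum>U\<in>\<U>. if y = s (\<omega> U) then measure M U *\<^sub>R y else 0)"
    by (auto simp: scaleR_sum_left intro!: sum.cong)
  also have "\<dots> = (\<Sum>U\<in>\<U>. \<Sum>y\<in>s ` space M. if y = s (\<omega> U) then measure M U *\<^sub>R y else 0)"
    by (rule sum.swap)
  also have "\<dots> = (\<Sum>U\<in>\<U>. measure M U *\<^sub>R s (\<omega> U))"
    using fs tagsp by (intro sum.cong) (simp_all add: sum.delta)
  finally show ?thesis ..
qed

lemma simple_bochner_integral_eq_sum_over_family:
  fixes s :: "'a \<Rightarrow> 'x::banach"
  assumes "simple_function M s" and fin: "finite \<U>" and sets: "\<U> \<subseteq> sets M" and disj: "disjoint \<U>"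
    and tag: "\<And>U. U \<in> \<U> \<Longrightarrow> \<omega> U \<in> U"
    and const: "\<And>U x. U \<in> \<U> \<Longrightarrow> x \<in> U \<Longrightarrow> s x = s (\<omega> U)"
    and zero: "\<And>x. x \<in> space M \<Longrightarrow> x \<notin> \<Union>\<U> \<Longrightarrow> s x = 0"
  shows "simple_int M s = (\<Sum>U\<in>\<U>. measure M U *\<^sub>R s (\<omega> U))"
proof -
  have "measure M {x \<in> space M. s x = y} *\<^sub>R y = measure M ({x \<in> space M. s x = y} \<inter> \<Union>\<U>) *\<^sub>R y" for y
  proof (cases "y = 0")
    case False
    then have "{x \<in> space M. s x = y} \<inter> \<Union>\<U> = {x \<in> space M. s x = y}" using zero by blast
    then show ?thesis by simp
  qed simp
  then have "simple_int M s = (\<Sum>y\<in>s ` space M. measure M ({x \<in> space M. s x = y} \<inter> \<Union>\<U>) *\<^sub>R y)"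
    unfolding simple_bochner_integral_def by (rule sum.cong[OF refl])
  also have "\<dots> = (\<Sum>U\<in>\<U>. measure M U *\<^sub>R s (\<omega> U))"
    by (rule sum_simple_function_over_family[OF assms(1-4), symmetric]) (fact tag, fact const)
  finally show ?thesis .
qed

lemma sum_levels_tendsto_simple_bochner_integral:
  fixes s :: "'a \<Rightarrow> 'x::banach"
  assumes "simple_function M s" and W: "range W \<subseteq> sets M" "incseq W" "(\<Union>n. W n) = space M"
  shows "(\<lambda>n. \<Sum>y\<in>s ` space M. measure M ({x \<in> space M. s x = y} \<inter> W n) *\<^sub>R y)
    \<longlonglongrightarrow> simple_int M s"
  unfolding simple_bochner_integral_def
proof (intro tendsto_sum tendsto_scaleR tendsto_const)
  fix y
  have lev: "{x \<in> space M. s x = y} \<in> sets M"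
    using simple_functionD(2)[OF assms(1), of "{y}"] by (simp add: vimage_def Int_def conj_commute)
  have "(\<Union>n. {x \<in> space M. s x = y} \<inter> W n) = {x \<in> space M. s x = y}" using W(3) by auto
  moreover have "(\<lambda>n. measure M ({x \<in> space M. s x = y} \<inter> W n))
      \<longlonglongrightarrow> measure M (\<Union>n. {x \<in> space M. s x = y} \<inter> W n)"
    using lev W by (intro finite_Lim_measure_incseq) (auto simp: incseq_def)
  ultimately show "(\<lambda>n. measure M ({x \<in> space M. s x = y} \<inter> W n)) \<longlonglongrightarrow> measure M {x \<in> space M. s x = y}"
    by simp
qed

text \<open>
  Exhausting the space by finitely many of the cells on which both \<open>p\<close> and \<open>s\<close> are constant, the
  integral of \<open>s\<close> is a limit of sums over tagged families. This is where countable additivity of the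
  measure makes the integral continuous for the seminorm.
\<close>

lemma norm_simple_bochner_integral_le:
  fixes s :: "'a \<Rightarrow> 'x::banach"
  assumes s: "simple_function M s" and "birkhoff_bound M c s"
  shows "norm (simple_int M s) \<le> c"
proof -
  obtain p where p: "p \<in> measurable M (count_space (UNIV :: nat set))"
    "birkhoff_bound_along M p c s"
    using assms(2) unfolding birkhoff_bound_def by blast
  note p = p(1) birkhoff_bound_alongD[OF p(2)]
  note [measurable] = p(1)
  have lev: "{x \<in> space M. s x = y} \<in> sets M" for y
    using simple_functionD(2)[OF assms(1), of "{y}"] by (simp add: vimage_def Int_def conj_commute)
  define fib where "fib i y = {x \<in> space M. p x = i \<and> s x = y}" for i y
  have fib: "fib i y \<in> sets M" for i y
  proof -
    have "fib i y = {x \<in> space M. p x = i} \<inter> {x \<in> space M. s x = y}" by (auto simp: fib_def)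
    then show ?thesis using lev by simp
  qed
  define \<U> where "\<U> n = (\<lambda>(i, y). fib i y) ` ({..<n} \<times> s ` space M) - {{}}" for n
  define \<omega> where "\<omega> U = (SOME x. x \<in> U)" for U :: "'a set"
  have tag: "\<omega> U \<in> U" if "U \<in> \<U> n" for U n
    using that by (auto simp: \<U>_def \<omega>_def some_in_eq)
  have const: "s x = s (\<omega> U)" "p x = p (\<omega> U)" if "U \<in> \<U> n" "x \<in> U" for U x n
    using that tag[OF that(1)] by (auto simp: \<U>_def fib_def)
  have fin: "finite (\<U> n)" for n
    using simple_functionD(1)[OF s] by (simp add: \<U>_def)
  have sub: "\<U> n \<subseteq> sets M" for n using fib by (auto simp: \<U>_def)
  have disj: "disjoint (\<U> n)" for n by (auto simp: \<U>_def fib_def disjoint_def)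
  have un: "\<Union>(\<U> n) = {x \<in> space M. p x < n}" for n
    by (auto simp: \<U>_def fib_def)
  have "norm (\<Sum>y\<in>s ` space M. measure M ({x \<in> space M. s x = y} \<inter> {x \<in> space M. p x < n}) *\<^sub>R y) \<le> c" for n
  proof -
    have T: "tagged_family M p (\<U> n) \<omega>"
      unfolding tagged_family_def using fin sub disj tag const by blast
    have "(\<Sum>U\<in>\<U> n. measure M U *\<^sub>R s (\<omega> U)) =
        (\<Sum>y\<in>s ` space M. measure M ({x \<in> space M. s x = y} \<inter> \<Union>(\<U> n)) *\<^sub>R y)"
      by (rule sum_simple_function_over_family[OF s fin sub disj]) (fact tag, fact const(1))
    with p(2)[OF T] show ?thesis by (simp only: un)
  qed
  moreover have "(\<lambda>n. \<Sum>y\<in>s ` space M. measure M ({x \<in> space M. s x = y} \<inter> {x \<in> space M. p x < n}) *\<^sub>R y)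
      \<longlonglongrightarrow> simple_int M s"
    by (rule sum_levels_tendsto_simple_bochner_integral[OF s]) (auto simp: incseq_def)
  ultimately show ?thesis
    by (intro LIMSEQ_le_const2[OF tendsto_norm]) auto
qed

end

section \<open>The Birkhoff integral as a completion of the simple functions\<close>

lemma convex_sum_subprobability:
  fixes y :: "'i \<Rightarrow> 'b::real_vector"
  assumes "convex S" "0 \<in> S" "finite I"
    and "\<And>i. i \<in> I \<Longrightarrow> 0 \<le> t i" "\<And>i. i \<in> I \<Longrightarrow> y i \<in> S" "sum t I \<le> 1"
  shows "(\<Sum>i\<in>I. t i *\<^sub>R y i) \<in> S"
proof (cases "sum t I = 0")
  case True
  then have "t i = 0" if "i \<in> I" for i
    using that assms(3,4) by (simp add: sum_nonneg_eq_0_iff)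
  then show ?thesis using \<open>0 \<in> S\<close> by simp
next
  case False
  moreover have "0 \<le> sum t I" using assms(4) by (rule sum_nonneg)
  ultimately have T: "0 < sum t I" by simp
  have "(\<Sum>i\<in>I. (t i / sum t I) *\<^sub>R y i) \<in> S"
    using assms T by (intro convex_sum) (auto simp: sum_divide_distrib[symmetric])
  then have "(1 - sum t I) *\<^sub>R 0 + sum t I *\<^sub>R (\<Sum>i\<in>I. (t i / sum t I) *\<^sub>R y i) \<in> S"
    using assms(1,2,6) T by (intro convexD) auto
  then show ?thesis using T by (simp add: scaleR_sum_right)
qed

context finite_measure
begin

text \<open>
  Take a partition \<open>P\<close> belonging to \<open>\<epsilon> / 4\<close>, choose tags, and let \<open>s\<close> have the tag value of \<open>f\<close> on each
  of the finitely many cells beyond which the tagged sums no longer leave the \<open>\<epsilon> / 4\<close>-ball around \<open>J\<close>.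
  Changing the tags on finitely many cells alters the total by at most \<open>2 * \<epsilon> / 4\<close>, and the cells left out
  of \<open>s\<close> contribute at most as much; this is the seminorm estimate for families consisting of whole
  cells. If the cells are subdivided, the contribution of a cell lies in the convex hull of \<open>0\<close> and
  the contributions for the possible tags of the whole cell, so the same estimate holds.
\<close>

lemma has_Bi1_integral_imp_simple_approximation:
  fixes f :: "'a \<Rightarrow> 'x::banach"
  assumes "has_Bi1_integral M f J" "0 < \<epsilon>"
  obtains s where "simple_function M s" "birkhoff_bound M \<epsilon> (\<lambda>x. f x - s x)"
    "norm (simple_int M s - J) \<le> \<epsilon>"
proof -
  obtain P where P: "measurable_partition M P"
    and lim: "\<forall>\<omega>. (\<forall>V\<in>P. \<omega> V \<in> V) \<longrightarrow>
      (\<forall>\<^sub>F G in finite_subsets_at_top P. norm ((\<Sum>V\<in>G. measure M V *\<^sub>R f (\<omega> V)) - J) < \<epsilon> / 4)"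
    using has_Bi1_integral_eventually[OF assms(1), of "\<epsilon> / 4"] assms(2) by auto
  have Psets: "P \<subseteq> sets M" and disj: "disjoint P" and Pne: "{} \<notin> P" and PU: "\<Union>P = space M"
    using P by (auto simp: measurable_partition_def partition_on_def)
  define tag where "tag V = (SOME x. x \<in> V)" for V :: "'a set"
  have tag: "tag V \<in> V" if "V \<in> P" for V
    using that Pne by (auto simp: tag_def some_in_eq)
  define S where "S \<omega> G = (\<Sum>V\<in>G. measure M V *\<^sub>R f (\<omega> V))" for \<omega> :: "'a set \<Rightarrow> 'a" and G
  have threshold: "\<exists>F. finite F \<and> F \<subseteq> P \<and> (\<forall>G. finite G \<longrightarrow> F \<subseteq> G \<longrightarrow> G \<subseteq> P \<longrightarrow> norm (S \<omega> G - J) < \<epsilon> / 4)"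
    if "\<And>V. V \<in> P \<Longrightarrow> \<omega> V \<in> V" for \<omega>
  proof -
    have "\<forall>\<^sub>F G in finite_subsets_at_top P. norm (S \<omega> G - J) < \<epsilon> / 4"
      using lim that by (simp add: S_def)
    then show ?thesis
      by (simp only: eventually_finite_subsets_at_top imp_conjL)
  qed
  obtain F where F: "finite F" "F \<subseteq> P"
    and F_lim: "\<And>G. finite G \<Longrightarrow> F \<subseteq> G \<Longrightarrow> G \<subseteq> P \<Longrightarrow> norm (S tag G - J) < \<epsilon> / 4"
    using threshold[OF tag] by blast
  define s where "s x = (\<Sum>V\<in>F. indicator V x *\<^sub>R f (tag V))" for x
  have s_eq: "s x = (if V \<in> F then f (tag V) else 0)" if "V \<in> P" "x \<in> V" for x V
  proof -
    have "s x = (\<Sum>V'\<in>F. if V' = V then f (tag V') else 0)"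
      unfolding s_def using that F(2) disjointD[OF disj]
      by (intro sum.cong) (auto simp: indicator_def)
    then show ?thesis using F(1) by (simp add: sum.delta)
  qed
  have s: "simple_function M s"
    unfolding s_def using F Psets
    by (intro simple_function_sum simple_function_compose1[where g = "\<lambda>r. r *\<^sub>R _"] simple_function_indicator) auto
  have int_s: "simple_int M s = S tag F"
  proof -
    have "simple_int M s = (\<Sum>V\<in>F. measure M V *\<^sub>R s (tag V))"
    proof (rule simple_bochner_integral_eq_sum_over_family[OF s \<open>finite F\<close>])
      show "F \<subseteq> sets M" "disjoint F" using F(2) Psets disj by (auto intro: pairwise_subset)
      show "tag V \<in> V" if "V \<in> F" for V using that tag F(2) by blast
      then show "s x = s (tag V)" if "V \<in> F" "x \<in> V" for x V
        using that s_eq F(2) by (metis subsetD)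
      show "s x = 0" if "x \<in> space M" "x \<notin> \<Union>F" for x
        using that by (auto simp: s_def intro!: sum.neutral)
    qed
    also have "\<dots> = S tag F" unfolding S_def
      using s_eq tag F(2) by (intro sum.cong) (metis subsetD)+
    finally show ?thesis .
  qed
  let ?d = "\<lambda>x. f x - s x"
  \<comment> \<open>Tags \<open>\<eta>'\<close> that differ from \<open>tag\<close> only on \<open>G\<close> have a threshold of their own; on a common
    superset \<open>?H\<close> of the thresholds all terms cancel except the changes of tags.\<close>
  have choice: "norm (\<Sum>V\<in>G. measure M V *\<^sub>R ?d (\<eta> V)) \<le> \<epsilon>"
    if G: "finite G" "G \<subseteq> P" and \<eta>: "\<And>V. V \<in> G \<Longrightarrow> \<eta> V \<in> V" for G \<eta>
  proof -
    define \<eta>' where "\<eta>' V = (if V \<in> G then \<eta> V else tag V)" for V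
    have \<eta>': "\<eta>' V \<in> V" if "V \<in> P" for V using that \<eta> tag by (simp add: \<eta>'_def)
    obtain F' where F': "finite F'" "F' \<subseteq> P"
      and F'_lim: "\<And>G. finite G \<Longrightarrow> F' \<subseteq> G \<Longrightarrow> G \<subseteq> P \<Longrightarrow> norm (S \<eta>' G - J) < \<epsilon> / 4"
      using threshold[OF \<eta>'] by blast
    let ?H = "F \<union> F' \<union> G"
    have "(\<Sum>V\<in>G. measure M V *\<^sub>R (f (\<eta> V) - f (tag V))) =
        (\<Sum>V\<in>?H. measure M V *\<^sub>R (f (\<eta>' V) - f (tag V)))"
      using F(1) F'(1) G(1) by (intro sum.mono_neutral_cong_left) (auto simp: \<eta>'_def)
    also have "\<dots> = S \<eta>' ?H - S tag ?H"
      by (simp add: S_def scaleR_diff_right sum_subtractf)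
    finally have 1: "(\<Sum>V\<in>G. measure M V *\<^sub>R (f (\<eta> V) - f (tag V))) = S \<eta>' ?H - S tag ?H" .
    have "S tag (F \<union> G) = S tag F + S tag (G - F)"
      unfolding S_def using F(1) G(1) sum.union_disjoint[of F "G - F"] by auto
    then have 2: "(\<Sum>V\<in>G. if V \<in> F then 0 else measure M V *\<^sub>R f (tag V)) = S tag (F \<union> G) - S tag F"
      using G(1) by (simp add: S_def sum.If_cases Diff_eq)
    have "(\<Sum>V\<in>G. measure M V *\<^sub>R ?d (\<eta> V)) = (\<Sum>V\<in>G. measure M V *\<^sub>R (f (\<eta> V) - f (tag V)) +
        (if V \<in> F then 0 else measure M V *\<^sub>R f (tag V)))"
    proof (intro sum.cong refl)
      fix V assume "V \<in> G"
      then have "s (\<eta> V) = (if V \<in> F then f (tag V) else 0)" using s_eq \<eta> G(2) by blast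
      then show "measure M V *\<^sub>R ?d (\<eta> V) = measure M V *\<^sub>R (f (\<eta> V) - f (tag V)) +
        (if V \<in> F then 0 else measure M V *\<^sub>R f (tag V))"
        by (simp add: scaleR_diff_right)
    qed
    also have "\<dots> = ((S \<eta>' ?H - J) - (S tag ?H - J)) + ((S tag (F \<union> G) - J) - (S tag F - J))"
      by (simp add: sum.distrib 1 2)
    also have "norm \<dots> \<le> (\<epsilon> / 4 + \<epsilon> / 4) + (\<epsilon> / 4 + \<epsilon> / 4)"
      using F F' G
      by (intro norm_triangle_mono norm_triangle_le_diff add_mono less_imp_le[OF F_lim] less_imp_le[OF F'_lim]) auto
    finally show ?thesis by simp
  qed
  obtain p :: "'a \<Rightarrow> nat" where p: "p \<in> measurable M (count_space UNIV)"
    and p_cell: "\<And>x y V. x \<in> space M \<Longrightarrow> V \<in> P \<Longrightarrow> y \<in> V \<Longrightarrow> p x = p y \<Longrightarrow> x \<in> V"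
    using measurable_partition_index[OF P] by blast
  have "birkhoff_bound M \<epsilon> ?d"
  proof (rule birkhoff_boundI[OF p])
    fix \<U> \<omega> assume T: "tagged_family M p \<U> \<omega>"
    then have fin: "finite \<U>" and sets: "\<U> \<subseteq> sets M" and dU: "disjoint \<U>"
      unfolding tagged_family_def by blast+
    define cell where "cell U = (SOME V. V \<in> P \<and> \<omega> U \<in> V)" for U
    have cell: "cell U \<in> P" "\<omega> U \<in> cell U" if "U \<in> \<U>" for U
    proof -
      have "\<exists>V. V \<in> P \<and> \<omega> U \<in> V" using PU tagged_family_tag_in_space[OF T that] by blast
      then show "cell U \<in> P" "\<omega> U \<in> cell U" unfolding cell_def by (metis (mono_tags, lifting) someI_ex)+
    qed
    have sub: "U \<subseteq> cell U" if "U \<in> \<U>" for U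
    proof
      fix x assume "x \<in> U"
      then have "x \<in> space M" "p x = p (\<omega> U)"
        using T that sets.sets_into_space unfolding tagged_family_def by blast+
      then show "x \<in> cell U" using p_cell cell[OF that] by blast
    qed
    define z where "z V = (\<Sum>U\<in>{U \<in> \<U>. cell U = V}. measure M U *\<^sub>R ?d (\<omega> U))" for V
    define K where "K V = insert 0 ((\<lambda>x. measure M V *\<^sub>R ?d x) ` V)" for V
    have "norm (sum z (cell ` \<U>)) \<le> \<epsilon>"
    proof (rule norm_sum_convex_hull_le[where K = K])
      show "finite (cell ` \<U>)" using fin by simp
    next
      fix y assume y: "\<And>V. V \<in> cell ` \<U> \<Longrightarrow> y V \<in> K V"
      \<comment> \<open>The choice \<open>0\<close> in \<open>K V\<close> amounts to leaving the cell \<open>V\<close> out.\<close>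
      define G where "G = {V \<in> cell ` \<U>. y V \<noteq> 0}"
      have "\<exists>x. x \<in> V \<and> y V = measure M V *\<^sub>R ?d x" if "V \<in> G" for V
        using that y[of V] by (auto simp: G_def K_def)
      then obtain \<eta> where \<eta>: "\<And>V. V \<in> G \<Longrightarrow> \<eta> V \<in> V" "\<And>V. V \<in> G \<Longrightarrow> y V = measure M V *\<^sub>R ?d (\<eta> V)"
        by metis
      have "sum y (cell ` \<U>) = sum y G"
        using fin by (intro sum.mono_neutral_right) (auto simp: G_def)
      also have "\<dots> = (\<Sum>V\<in>G. measure M V *\<^sub>R ?d (\<eta> V))"
        using \<eta>(2) by (rule sum.cong[OF refl])
      also have "norm \<dots> \<le> \<epsilon>"
      proof (rule choice)
        show "finite G" "G \<subseteq> P" using fin cell(1) by (auto simp: G_def)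
      qed (fact \<eta>(1))
      finally show "norm (sum y (cell ` \<U>)) \<le> \<epsilon>" .
    next
      fix V assume "V \<in> cell ` \<U>"
      then have V: "V \<in> P" "V \<in> sets M" using cell(1) Psets by auto
      let ?\<V> = "{U \<in> \<U>. cell U = V}"
      have sum_le: "(\<Sum>U\<in>?\<V>. measure M U) \<le> measure M V"
      proof -
        have "(\<Sum>U\<in>?\<V>. measure M U) = measure M (\<Union>?\<V>)"
          using fin sets dU
          by (subst measure_Union') (auto simp: fmeasurable_eq_sets pairwise_def)
        also have "\<dots> \<le> measure M V" using sub V by (intro finite_measure_mono) auto
        finally show ?thesis .
      qed
      show "z V \<in> convex hull (K V)"
      proof (cases "measure M V = 0")
        case True
        have "measure M U = 0" if "U \<in> ?\<V>" for U
          using that finite_measure_mono[of U V] sub[of U] V True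
          by (auto simp: measure_le_0_iff)
        then have "z V = 0" unfolding z_def by (intro sum.neutral) simp
        then show ?thesis by (auto simp: K_def intro: hull_inc)
      next
        case False
        then have pos: "0 < measure M V" by (simp add: zero_less_measure_iff)
        have "z V = (\<Sum>U\<in>?\<V>. (measure M U / measure M V) *\<^sub>R (measure M V *\<^sub>R ?d (\<omega> U)))"
          using False by (simp add: z_def)
        also have "\<dots> \<in> convex hull (K V)"
        proof (rule convex_sum_subprobability)
          show "(\<Sum>U\<in>?\<V>. measure M U / measure M V) \<le> 1"
            using sum_le pos by (simp add: sum_divide_distrib[symmetric])
          show "0 \<in> convex hull (K V)" by (auto simp: K_def intro: hull_inc)
          show "measure M V *\<^sub>R ?d (\<omega> U) \<in> convex hull (K V)" if "U \<in> ?\<V>" for U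
            using that cell(2)[of U] by (auto simp: K_def intro!: hull_inc)
        qed (use fin in auto)
        finally show ?thesis .
      qed
    qed
    moreover have "(\<Sum>U\<in>\<U>. measure M U *\<^sub>R ?d (\<omega> U)) = sum z (cell ` \<U>)"
      unfolding z_def by (rule sum.image_gen[OF fin])
    ultimately show "norm (\<Sum>U\<in>\<U>. measure M U *\<^sub>R ?d (\<omega> U)) \<le> \<epsilon>" by simp
  qed
  moreover have "norm (simple_int M s - J) \<le> \<epsilon>"
    using F_lim[of F] F assms(2) by (simp add: int_s)
  ultimately show ?thesis using s that by blast
qed

text \<open>
  For a partition on whose cells both \<open>s\<close> and the index function of the seminorm estimate are constant, the
  partial sums of \<open>f\<close> and of \<open>s\<close> differ by little, and those of \<open>s\<close> converge to its integral.
\<close>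

lemma has_Bi1_integralI_simple_approximation:
  fixes f :: "'a \<Rightarrow> 'x::banach"
  assumes approx: "\<And>\<epsilon>. 0 < \<epsilon> \<Longrightarrow> \<exists>s. simple_function M s \<and> birkhoff_bound M \<epsilon> (\<lambda>x. f x - s x) \<and>
      norm (simple_int M s - J) \<le> \<epsilon>"
  shows "has_Bi1_integral M f J"
  unfolding has_Bi1_integral_def
proof (intro allI impI)
  fix \<epsilon> :: real assume "0 < \<epsilon>"
  obtain s where s: "simple_function M s" and "birkhoff_bound M (\<epsilon> / 4) (\<lambda>x. f x - s x)"
    and int_s: "norm (simple_int M s - J) \<le> \<epsilon> / 4"
    using approx[of "\<epsilon> / 4"] \<open>0 < \<epsilon>\<close> by auto
  then obtain p where p: "p \<in> measurable M (count_space (UNIV :: nat set))"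
    "birkhoff_bound_along M p (\<epsilon> / 4) (\<lambda>x. f x - s x)"
    unfolding birkhoff_bound_def by blast
  note [measurable] = p(1)
  have lev: "{x \<in> space M. s x = y} \<in> sets M" for y
    using simple_functionD(2)[OF s, of "{y}"] by (simp add: vimage_def Int_def conj_commute)
  define fib where "fib i y = {x \<in> space M. p x = i \<and> s x = y}" for i y
  have fib: "fib i y \<in> sets M" for i y
  proof -
    have "fib i y = {x \<in> space M. p x = i} \<inter> {x \<in> space M. s x = y}" by (auto simp: fib_def)
    then show ?thesis using lev by simp
  qed
  define P where "P = (\<lambda>(i, y). fib i y) ` (UNIV \<times> s ` space M) - {{}}"
  have "measurable_partition M P"
    unfolding measurable_partition_def
  proof (intro conjI)
    have "countable (UNIV \<times> s ` space M :: (nat \<times> 'x) set)"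
      using simple_functionD(1)[OF s] by (intro countable_SIGMA) (auto intro: countable_finite)
    then show "countable P" unfolding P_def by (intro countable_Diff countable_image)
    show "P \<subseteq> sets M" using fib by (auto simp: P_def)
    show "partition_on (space M) P"
      unfolding partition_on_def by (auto simp: P_def fib_def disjoint_def)
  qed
  moreover have "limsup (\<lambda>n. ereal (norm ((\<Sum>k\<in>{..<n} \<inter> I. measure M (U k) *\<^sub>R f (\<omega> k)) - J))) < ereal \<epsilon>"
    if U: "partition_enum M I U" and ref: "refines (space M) (U ` I) P" and \<omega>: "\<forall>k\<in>I. \<omega> k \<in> U k"
    for I U \<omega>
  proof -
    have inj: "inj_on U I" and Usets: "U ` I \<subseteq> sets M" and disj: "disjoint (U ` I)" and UN: "\<Union>(U ` I) = space M"
      using U by (auto simp: partition_enum_def measurable_partition_def partition_on_def)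
    have const: "s x = s (\<omega> k) \<and> p x = p (\<omega> k)" if "k \<in> I" "x \<in> U k" for k x
    proof -
      obtain V where "V \<in> P" "U k \<subseteq> V" using ref \<open>k \<in> I\<close> by (auto simp: refines_def)
      then have "x \<in> V" "\<omega> k \<in> V" using that \<omega> by auto
      then show ?thesis using \<open>V \<in> P\<close> by (auto simp: P_def fib_def)
    qed
    define W where "W n = \<Union>(U ` ({..<n} \<inter> I))" for n
    \<comment> \<open>The family lemmas attach tags to sets, the definition of the integral attaches them to indices.\<close>
  define \<tau> where "\<tau> V = \<omega> (the_inv_into I U V)" for V
    have \<tau>: "\<tau> (U k) = \<omega> k" if "k \<in> I" for k using that inj by (simp add: \<tau>_def the_inv_into_f_f)
    have reindex: "(\<Sum>k\<in>{..<n} \<inter> I. measure M (U k) *\<^sub>R g (\<omega> k)) =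
        (\<Sum>V\<in>U ` ({..<n} \<inter> I). measure M V *\<^sub>R g (\<tau> V))" for n and g :: "'a \<Rightarrow> 'x"
    proof -
      have "inj_on U ({..<n} \<inter> I)" using inj by (rule inj_on_subset) auto
      then show ?thesis using \<tau> by (simp add: sum.reindex)
    qed
    have fam: "finite (U ` ({..<n} \<inter> I))" "U ` ({..<n} \<inter> I) \<subseteq> sets M" "disjoint (U ` ({..<n} \<inter> I))" for n
      using Usets by (auto intro: pairwise_subset[OF disj])
    have T: "tagged_family M p (U ` ({..<n} \<inter> I)) \<tau>" for n
      unfolding tagged_family_def
    proof (intro conjI ballI)
      fix V assume "V \<in> U ` ({..<n} \<inter> I)"
      then obtain k where k: "k \<in> I" "V = U k" by auto
      then show "\<tau> V \<in> V" using \<tau> \<omega> by auto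
      show "p x = p (\<tau> V)" if "x \<in> V" for x
        using const[OF k(1), of x] that unfolding k(2) \<tau>[OF k(1)] by simp
    qed (use fam in auto)
    have sum_s: "(\<Sum>k\<in>{..<n} \<inter> I. measure M (U k) *\<^sub>R s (\<omega> k)) =
        (\<Sum>y\<in>s ` space M. measure M ({x \<in> space M. s x = y} \<inter> W n) *\<^sub>R y)" for n
      unfolding reindex W_def
    proof (rule sum_simple_function_over_family[OF s fam])
      fix V assume "V \<in> U ` ({..<n} \<inter> I)"
      then obtain k where k: "k \<in> I" "V = U k" by auto
      then show "\<tau> V \<in> V" using \<tau> \<omega> by auto
      show "s x = s (\<tau> V)" if "x \<in> V" for x
        using const[OF k(1), of x] that unfolding k(2) \<tau>[OF k(1)] by simp
    qed
    have lim_s: "(\<lambda>n. \<Sum>k\<in>{..<n} \<inter> I. measure M (U k) *\<^sub>R s (\<omega> k)) \<longlonglongrightarrow> simple_int M s"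
      unfolding sum_s
    proof (rule sum_levels_tendsto_simple_bochner_integral[OF s])
      show "range W \<subseteq> sets M" using fam by (auto simp: W_def)
      show "incseq W" by (force simp: incseq_def W_def)
      show "(\<Union>n. W n) = space M" unfolding UN[symmetric] W_def by auto
    qed
    have "\<forall>\<^sub>F n in sequentially. norm ((\<Sum>k\<in>{..<n} \<inter> I. measure M (U k) *\<^sub>R s (\<omega> k)) - simple_int M s) < \<epsilon> / 4"
      using tendstoD[OF lim_s, of "\<epsilon> / 4"] \<open>0 < \<epsilon>\<close> by (simp add: dist_norm)
    then have "\<forall>\<^sub>F n in sequentially.
        ereal (norm ((\<Sum>k\<in>{..<n} \<inter> I. measure M (U k) *\<^sub>R f (\<omega> k)) - J)) \<le> ereal (3 * \<epsilon> / 4)"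
    proof eventually_elim
      case (elim n)
      let ?f = "\<Sum>k\<in>{..<n} \<inter> I. measure M (U k) *\<^sub>R f (\<omega> k)"
      let ?s = "\<Sum>k\<in>{..<n} \<inter> I. measure M (U k) *\<^sub>R s (\<omega> k)"
      have "?f - ?s = (\<Sum>k\<in>{..<n} \<inter> I. measure M (U k) *\<^sub>R (f (\<omega> k) - s (\<omega> k)))"
        by (simp add: scaleR_diff_right sum_subtractf)
      also have "norm \<dots> \<le> \<epsilon> / 4"
        unfolding reindex[where g = "\<lambda>x. f x - s x"] using birkhoff_bound_alongD[OF p(2) T] .
      finally have "norm ((?f - ?s) + (?s - simple_int M s) + (simple_int M s - J)) \<le> \<epsilon> / 4 + \<epsilon> / 4 + \<epsilon> / 4"
        using elim int_s by (intro norm_triangle_mono) auto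
      then show ?case by simp
    qed
    then have "limsup (\<lambda>n. ereal (norm ((\<Sum>k\<in>{..<n} \<inter> I. measure M (U k) *\<^sub>R f (\<omega> k)) - J))) \<le> ereal (3 * \<epsilon> / 4)"
      by (rule Limsup_bounded)
    also have "\<dots> < ereal \<epsilon>" using \<open>0 < \<epsilon>\<close> by simp
    finally show ?thesis .
  qed
  ultimately show "\<exists>P. measurable_partition M P \<and>
        (\<forall>I U \<omega>. partition_enum M I U \<and> refines (space M) (U ` I) P \<and> (\<forall>k\<in>I. \<omega> k \<in> U k) \<longrightarrow>
           limsup (\<lambda>n. ereal (norm ((\<Sum>k\<in>{..<n} \<inter> I. measure M (U k) *\<^sub>R f (\<omega> k)) - J))) < ereal \<epsilon>)"
    by (intro exI[of _ P] conjI allI impI) (simp, elim conjE)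
qed

section \<open>Calculus of the Birkhoff integral\<close>

lemma simple_bochner_integrable_if_simple:
  "simple_function M s \<Longrightarrow> Bochner_Integration.simple_bochner_integrable M s"
  by (simp add: simple_bochner_integrable.simps)

lemma simple_int_add:
  fixes s t :: "'a \<Rightarrow> 'x::banach"
  shows "simple_function M s \<Longrightarrow> simple_function M t \<Longrightarrow>
    simple_int M (\<lambda>x. s x + t x) = simple_int M s + simple_int M t"
  by (intro simple_bochner_integral_add simple_bochner_integrable_if_simple)

lemma simple_int_scaleR:
  fixes s :: "'a \<Rightarrow> 'x::banach"
  assumes "simple_function M s"
  shows "simple_int M (\<lambda>x. a *\<^sub>R s x) = a *\<^sub>R simple_int M s"
  by (rule simple_bochner_integral_linear[OF _ simple_bochner_integrable_if_simple[OF assms]])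
    (simp add: linear_scale_self)

lemma norm_Bi1_integral_le:
  assumes "has_Bi1_integral M f J" "birkhoff_bound M c f"
  shows "norm J \<le> c"
proof (rule field_le_epsilon)
  fix e :: real assume "0 < e"
  then obtain s where s: "simple_function M s" "birkhoff_bound M (e / 2) (\<lambda>x. f x - s x)"
    "norm (simple_int M s - J) \<le> e / 2"
    using has_Bi1_integral_imp_simple_approximation[OF assms(1), of "e / 2"] by auto
  have "birkhoff_bound M (c + e / 2) s"
    using birkhoff_bound_diff[OF assms(2) s(2)] by simp
  then have "norm (simple_int M s) \<le> c + e / 2"
    by (rule norm_simple_bochner_integral_le[OF s(1)])
  moreover have "norm J \<le> norm (simple_int M s) + norm (simple_int M s - J)"
    using norm_triangle_sub[of J "simple_int M s"] by (simp add: norm_minus_commute)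
  ultimately show "norm J \<le> c + e" using s(3) by simp
qed

lemma has_Bi1_integral_approx:
  assumes "\<And>\<epsilon>. 0 < \<epsilon> \<Longrightarrow> \<exists>g K. has_Bi1_integral M g K \<and> birkhoff_bound M \<epsilon> (\<lambda>x. f x - g x) \<and> norm (K - J) \<le> \<epsilon>"
  shows "has_Bi1_integral M f J"
proof (rule has_Bi1_integralI_simple_approximation)
  fix \<epsilon> :: real assume "0 < \<epsilon>"
  then obtain g K where g: "has_Bi1_integral M g K" "birkhoff_bound M (\<epsilon> / 2) (\<lambda>x. f x - g x)"
      "norm (K - J) \<le> \<epsilon> / 2"
    using assms[of "\<epsilon> / 2"] by auto
  obtain s where s: "simple_function M s" "birkhoff_bound M (\<epsilon> / 2) (\<lambda>x. g x - s x)"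
    "norm (simple_int M s - K) \<le> \<epsilon> / 2"
    using has_Bi1_integral_imp_simple_approximation[OF g(1), of "\<epsilon> / 2"] \<open>0 < \<epsilon>\<close> by auto
  have "birkhoff_bound M \<epsilon> (\<lambda>x. f x - s x)"
    using birkhoff_bound_add[OF g(2) s(2)] by simp
  moreover have "norm (simple_int M s - J) \<le> \<epsilon>"
    using norm_triangle_mono[OF s(3) g(3)] by simp
  ultimately show "\<exists>s. simple_function M s \<and> birkhoff_bound M \<epsilon> (\<lambda>x. f x - s x) \<and>
      norm (simple_int M s - J) \<le> \<epsilon>"
    using s(1) by (intro exI conjI)
qed

lemma has_Bi1_integral_cong:
  assumes "has_Bi1_integral M f J" "\<And>x. x \<in> space M \<Longrightarrow> f x = g x"
  shows "has_Bi1_integral M g J"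
proof (rule has_Bi1_integral_approx)
  fix \<epsilon> :: real assume "0 < \<epsilon>"
  have "birkhoff_bound M \<epsilon> (\<lambda>x. g x - f x)"
  proof (rule birkhoff_bound_mono)
    show "birkhoff_bound M (0 * measure M (space M)) (\<lambda>x. g x - f x)"
      by (rule birkhoff_bound_uniform) (simp_all add: assms(2))
  qed (use \<open>0 < \<epsilon>\<close> in simp)
  then show "\<exists>h K. has_Bi1_integral M h K \<and> birkhoff_bound M \<epsilon> (\<lambda>x. g x - h x) \<and> norm (K - J) \<le> \<epsilon>"
    using assms(1) \<open>0 < \<epsilon>\<close> by (intro exI[of _ f] exI[of _ J]) simp
qed

lemma has_Bi1_integral_add:
  assumes "has_Bi1_integral M f J" "has_Bi1_integral M g K"
  shows "has_Bi1_integral M (\<lambda>x. f x + g x) (J + K)"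
proof (rule has_Bi1_integralI_simple_approximation)
  fix \<epsilon> :: real assume "0 < \<epsilon>"
  then have e: "0 < \<epsilon> / 2" by simp
  obtain s where s: "simple_function M s" "birkhoff_bound M (\<epsilon> / 2) (\<lambda>x. f x - s x)"
    "norm (simple_int M s - J) \<le> \<epsilon> / 2"
    by (rule has_Bi1_integral_imp_simple_approximation[OF assms(1) e])
  obtain t where t: "simple_function M t" "birkhoff_bound M (\<epsilon> / 2) (\<lambda>x. g x - t x)"
    "norm (simple_int M t - K) \<le> \<epsilon> / 2"
    by (rule has_Bi1_integral_imp_simple_approximation[OF assms(2) e])
  show "\<exists>u. simple_function M u \<and> birkhoff_bound M \<epsilon> (\<lambda>x. f x + g x - u x) \<and>
      norm (simple_int M u - (J + K)) \<le> \<epsilon>"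
  proof (intro exI[of _ "\<lambda>x. s x + t x"] conjI)
    show "birkhoff_bound M \<epsilon> (\<lambda>x. f x + g x - (s x + t x))"
      using birkhoff_bound_add[OF s(2) t(2)] by (simp add: algebra_simps)
    show "norm (simple_int M (\<lambda>x. s x + t x) - (J + K)) \<le> \<epsilon>"
      using norm_triangle_mono[OF s(3) t(3)]
      by (simp add: simple_int_add s(1) t(1) add_diff_add)
  qed (use s t in simp)
qed

lemma has_Bi1_integral_scaleR:
  assumes "has_Bi1_integral M f J"
  shows "has_Bi1_integral M (\<lambda>x. a *\<^sub>R f x) (a *\<^sub>R J)"
proof (rule has_Bi1_integralI_simple_approximation)
  fix \<epsilon> :: real assume "0 < \<epsilon>"
  define \<delta> where "\<delta> = \<epsilon> / (2 * \<bar>a\<bar> + 1)"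
  have \<delta>: "0 < \<delta>" using \<open>0 < \<epsilon>\<close> by (simp add: \<delta>_def)
  have le: "2 * \<bar>a\<bar> * \<delta> \<le> \<epsilon>" using \<open>0 < \<epsilon>\<close> by (simp add: \<delta>_def field_simps)
  obtain s where s: "simple_function M s" "birkhoff_bound M \<delta> (\<lambda>x. f x - s x)"
    "norm (simple_int M s - J) \<le> \<delta>"
    by (rule has_Bi1_integral_imp_simple_approximation[OF assms \<delta>])
  show "\<exists>u. simple_function M u \<and> birkhoff_bound M \<epsilon> (\<lambda>x. a *\<^sub>R f x - u x) \<and>
      norm (simple_int M u - a *\<^sub>R J) \<le> \<epsilon>"
  proof (intro exI[of _ "\<lambda>x. a *\<^sub>R s x"] conjI)
    show "simple_function M (\<lambda>x. a *\<^sub>R s x)" using s(1) by (rule simple_function_compose1)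
    show "birkhoff_bound M \<epsilon> (\<lambda>x. a *\<^sub>R f x - a *\<^sub>R s x)"
      using birkhoff_bound_mono[OF birkhoff_bound_mult[OF s(2), of "\<bar>a\<bar>" "\<lambda>_. a"] le]
      by (simp add: scaleR_diff_right)
    have "\<bar>a\<bar> * norm (simple_int M s - J) \<le> \<bar>a\<bar> * \<delta>" using s(3) by (rule mult_left_mono) simp
    also have "\<dots> \<le> \<epsilon>" using le \<delta> mult_nonneg_nonneg[of "\<bar>a\<bar>" \<delta>] by linarith
    finally show "norm (simple_int M (\<lambda>x. a *\<^sub>R s x) - a *\<^sub>R J) \<le> \<epsilon>"
      by (simp add: simple_int_scaleR s(1) scaleR_diff_right[symmetric])
  qed
qed

lemma has_Bi1_integral_diff:
  assumes "has_Bi1_integral M f J" "has_Bi1_integral M g K"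
  shows "has_Bi1_integral M (\<lambda>x. f x - g x) (J - K)"
  using has_Bi1_integral_add[OF assms(1) has_Bi1_integral_scaleR[OF assms(2), of "-1"]] by simp

lemma birkhoff_bound_zero: "birkhoff_bound M 0 (\<lambda>x. 0)"
  using birkhoff_bound_uniform[of "space M" 0 "\<lambda>x. 0"] by simp

lemma has_Bi1_integral_simple:
  assumes "simple_function M s"
  shows "has_Bi1_integral M s (simple_int M s)"
proof (rule has_Bi1_integralI_simple_approximation)
  fix \<epsilon> :: real assume "0 < \<epsilon>"
  then show "\<exists>t. simple_function M t \<and> birkhoff_bound M \<epsilon> (\<lambda>x. s x - t x) \<and>
      norm (simple_int M t - simple_int M s) \<le> \<epsilon>"
    using assms birkhoff_bound_mono[OF birkhoff_bound_zero, of \<epsilon>] by (intro exI[of _ s]) simp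
qed

lemma has_Bi1_integral_indicator:
  fixes v :: "'x::banach"
  assumes "D \<in> sets M"
  shows "has_Bi1_integral M (\<lambda>x. indicator D x *\<^sub>R v) (measure M D *\<^sub>R v)"
proof -
  let ?s = "\<lambda>x. indicator D x *\<^sub>R v"
  have s: "simple_function M ?s"
    by (rule simple_function_compose1[where g = "\<lambda>r. r *\<^sub>R v"]) (simp add: assms)
  have "simple_int M ?s = measure M D *\<^sub>R v"
  proof (cases "D = {}")
    case True
    then show ?thesis
      using simple_bochner_integral_eq_sum_over_family[OF s, of "{}"] by simp
  next
    case False
    then obtain d where d: "d \<in> D" by blast
    have "simple_int M ?s = (\<Sum>U\<in>{D}. measure M U *\<^sub>R ?s d)"
      using assms d by (intro simple_bochner_integral_eq_sum_over_family[OF s]) simp_all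
    then show ?thesis using d by simp
  qed
  then show ?thesis using has_Bi1_integral_simple[OF s] by simp
qed

lemma has_Bi1_integral_zero: "has_Bi1_integral M (\<lambda>x. 0) 0"
  using has_Bi1_integral_indicator[of "{}" 0] by simp

lemma has_Bi1_integral_sum:
  assumes "finite I" "\<And>i. i \<in> I \<Longrightarrow> has_Bi1_integral M (f i) (J i)"
  shows "has_Bi1_integral M (\<lambda>x. \<Sum>i\<in>I. f i x) (\<Sum>i\<in>I. J i)"
  using assms by (induction I rule: finite_induct) (simp_all add: has_Bi1_integral_zero has_Bi1_integral_add)

lemma has_Bi1_integral_unique:
  assumes "has_Bi1_integral M f J" "has_Bi1_integral M f K"
  shows "J = K"
proof -
  have "has_Bi1_integral M (\<lambda>x. 0) (J - K)"
    using has_Bi1_integral_diff[OF assms] by simp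
  from norm_Bi1_integral_le[OF this birkhoff_bound_zero] show ?thesis by simp
qed

text \<open>
  The integrals of approximating functions form a Cauchy sequence because the integral is bounded by
  the seminorm, and \<open>X\<close> is complete.
\<close>

lemma Bi1_integrable_approx:
  assumes "\<And>\<epsilon>. 0 < \<epsilon> \<Longrightarrow> \<exists>g. g \<in> Bi1 M \<and> birkhoff_bound M \<epsilon> (\<lambda>x. f x - g x)"
  shows "f \<in> Bi1 M"
proof -
  define e where "e n = inverse (real (Suc n))" for n
  have e: "0 < e n" for n by (simp add: e_def)
  have "\<forall>n. \<exists>g. \<exists>K. has_Bi1_integral M g K \<and> birkhoff_bound M (e n) (\<lambda>x. f x - g x)"
    using assms[OF e] unfolding Bi1_def by blast
  then obtain g where "\<forall>n. \<exists>K. has_Bi1_integral M (g n) K \<and> birkhoff_bound M (e n) (\<lambda>x. f x - g n x)"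
    by (rule choice[THEN exE])
  then obtain K where "\<forall>n. has_Bi1_integral M (g n) (K n) \<and> birkhoff_bound M (e n) (\<lambda>x. f x - g n x)"
    by (rule choice[THEN exE])
  then have g: "has_Bi1_integral M (g n) (K n)" "birkhoff_bound M (e n) (\<lambda>x. f x - g n x)" for n
    by simp_all
  have e0: "e \<longlonglongrightarrow> 0" unfolding e_def by (rule LIMSEQ_inverse_real_of_nat)
  have dist_le: "dist (K m) (K n) \<le> e n + e m" for m n
    unfolding dist_norm
    by (rule norm_Bi1_integral_le[OF has_Bi1_integral_diff[OF g(1) g(1)]])
      (use birkhoff_bound_diff[OF g(2)[of n] g(2)[of m]] in simp)
  have "Cauchy K"
  proof (rule metric_CauchyI)
    fix \<epsilon> :: real assume "0 < \<epsilon>"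
    then obtain N where N: "\<And>n. n \<ge> N \<Longrightarrow> e n < \<epsilon> / 2"
      using order_tendstoD(2)[OF e0, of "\<epsilon> / 2"] by (auto simp: eventually_sequentially)
    have "dist (K m) (K n) < \<epsilon>" if "m \<ge> N" "n \<ge> N" for m n
      using dist_le[of m n] N[OF that(1)] N[OF that(2)] by linarith
    then show "\<exists>N. \<forall>m\<ge>N. \<forall>n\<ge>N. dist (K m) (K n) < \<epsilon>" by blast
  qed
  then obtain J where J: "K \<longlonglongrightarrow> J" using Cauchy_convergent convergent_def by blast
  have "has_Bi1_integral M f J"
  proof (rule has_Bi1_integral_approx)
    fix \<epsilon> :: real assume "0 < \<epsilon>"
    then have "\<forall>\<^sub>F n in sequentially. e n < \<epsilon> \<and> dist (K n) J < \<epsilon>"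
      using order_tendstoD(2)[OF e0, of \<epsilon>] tendstoD[OF J, of \<epsilon>] by (simp add: eventually_conj)
    then obtain n where "e n < \<epsilon>" "dist (K n) J < \<epsilon>" by (auto simp: eventually_sequentially)
    then show "\<exists>g K. has_Bi1_integral M g K \<and> birkhoff_bound M \<epsilon> (\<lambda>x. f x - g x) \<and> norm (K - J) \<le> \<epsilon>"
      using g birkhoff_bound_mono[OF g(2), of n \<epsilon>]
      by (intro exI[of _ "g n"] exI[of _ "K n"]) (simp add: dist_norm)
  qed
  then show ?thesis by (auto simp: Bi1_def)
qed

lemma simple_function_bounded:
  fixes s :: "'a \<Rightarrow> 'x::real_normed_vector"
  assumes "simple_function M s"
  obtains C where "0 \<le> C" "\<And>x. x \<in> space M \<Longrightarrow> norm (s x) \<le> C"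
proof -
  have "bounded (s ` space M)" using simple_functionD(1)[OF assms] by (rule finite_imp_bounded)
  then show ?thesis using that unfolding bounded_pos by (metis imageI less_imp_le)
qed

lemma Bi1_simple_approximation:
  assumes "f \<in> Bi1 M" "0 < \<epsilon>"
  obtains s where "simple_function M s" "birkhoff_bound M \<epsilon> (\<lambda>x. f x - s x)"
  using assms has_Bi1_integral_imp_simple_approximation unfolding Bi1_def by blast

lemma Bi1_birkhoff_bounded:
  assumes "f \<in> Bi1 M"
  obtains C where "birkhoff_bound M C f"
proof -
  obtain s where s: "simple_function M s" "birkhoff_bound M 1 (\<lambda>x. f x - s x)"
    using Bi1_simple_approximation[OF assms, of 1] by auto
  obtain C where C: "0 \<le> C" "\<And>x. x \<in> space M \<Longrightarrow> norm (s x) \<le> C"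
    using simple_function_bounded[OF s(1)] by blast
  have "birkhoff_bound M (C * measure M (space M)) s"
    by (rule birkhoff_bound_uniform) (use C in auto)
  from birkhoff_bound_add[OF s(2) this] show ?thesis by (intro that) simp
qed

lemma bounded_measurable_simple_approximation:
  fixes a :: "'a \<Rightarrow> real"
  assumes "a \<in> borel_measurable N" "\<And>x. x \<in> space N \<Longrightarrow> \<bar>a x\<bar> \<le> K" "0 < \<delta>"
  obtains b where "simple_function N b" "\<And>x. x \<in> space N \<Longrightarrow> \<bar>a x - b x\<bar> \<le> \<delta>"
proof (rule that)
  note [measurable] = assms(1)
  let ?b = "\<lambda>x. of_int \<lfloor>a x / \<delta>\<rfloor> * \<delta>"
  have "\<lfloor>a x / \<delta>\<rfloor> \<in> {\<lfloor>- K / \<delta>\<rfloor>..\<lfloor>K / \<delta>\<rfloor>}" if "x \<in> space N" for x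
  proof -
    have "- K \<le> a x" "a x \<le> K" using assms(2)[OF that] by linarith+
    then show ?thesis
      using \<open>0 < \<delta>\<close> divide_right_mono[of "- K" "a x" \<delta>] divide_right_mono[of "a x" K \<delta>]
      by (auto intro!: floor_mono)
  qed
  then have "?b ` space N \<subseteq> (\<lambda>k. of_int k * \<delta>) ` {\<lfloor>- K / \<delta>\<rfloor>..\<lfloor>K / \<delta>\<rfloor>}" by auto
  then have "finite (?b ` space N)" by (rule finite_subset) simp
  then show "simple_function N ?b"
    by (intro simple_function_borel_measurable) auto
  fix x
  have "a x - ?b x = (a x / \<delta> - of_int \<lfloor>a x / \<delta>\<rfloor>) * \<delta>" using \<open>0 < \<delta>\<close> by (simp add: field_simps)
  moreover have "0 \<le> a x / \<delta> - of_int \<lfloor>a x / \<delta>\<rfloor>" "a x / \<delta> - of_int \<lfloor>a x / \<delta>\<rfloor> \<le> 1"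
    by linarith+
  ultimately show "\<bar>a x - ?b x\<bar> \<le> \<delta>"
    using \<open>0 < \<delta>\<close> by (simp add: abs_mult mult_left_le_one_le)
qed

text \<open>
  Multiplication by a bounded function is continuous for the seminorm, and a simple function times
  a bounded measurable one is a uniform limit of simple functions. In particular, integrability passes to
  measurable subsets.
\<close>

lemma Bi1_mult_bounded:
  assumes f: "f \<in> Bi1 M" and a: "a \<in> borel_measurable M" "\<And>x. x \<in> space M \<Longrightarrow> \<bar>a x\<bar> \<le> K"
  shows "(\<lambda>x. a x *\<^sub>R f x) \<in> Bi1 M"
proof (rule Bi1_integrable_approx)
  fix \<epsilon> :: real assume "0 < \<epsilon>"
  define \<eta> where "\<eta> = \<epsilon> / (2 * (2 * \<bar>K\<bar> + 1))"
  have \<eta>: "0 < \<eta>" using \<open>0 < \<epsilon>\<close> by (simp add: \<eta>_def)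
  have \<eta>_le: "2 * \<bar>K\<bar> * \<eta> \<le> \<epsilon> / 2" using \<open>0 < \<epsilon>\<close> by (simp add: \<eta>_def field_simps)
  obtain s where s: "simple_function M s" "birkhoff_bound M \<eta> (\<lambda>x. f x - s x)"
    by (rule Bi1_simple_approximation[OF f \<eta>])
  obtain C where C: "0 \<le> C" "\<And>x. x \<in> space M \<Longrightarrow> norm (s x) \<le> C"
    using simple_function_bounded[OF s(1)] by blast
  define \<delta> where "\<delta> = \<epsilon> / (2 * (C * measure M (space M) + 1))"
  have pos: "0 < C * measure M (space M) + 1" using C(1) by (simp add: add_nonneg_pos)
  then have \<delta>: "0 < \<delta>" using \<open>0 < \<epsilon>\<close> by (simp add: \<delta>_def)
  have \<delta>_le: "\<delta> * C * measure M (space M) \<le> \<epsilon> / 2"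
    using \<open>0 < \<epsilon>\<close> pos by (simp add: \<delta>_def field_simps)
  obtain b where b: "simple_function M b" "\<And>x. x \<in> space M \<Longrightarrow> \<bar>a x - b x\<bar> \<le> \<delta>"
    using bounded_measurable_simple_approximation[OF a \<delta>] by blast
  have "birkhoff_bound M (2 * \<bar>K\<bar> * \<eta>) (\<lambda>x. a x *\<^sub>R (f x - s x))"
    by (rule birkhoff_bound_mult[OF s(2)]) (use a(2) in force)+
  then have 1: "birkhoff_bound M (\<epsilon> / 2) (\<lambda>x. a x *\<^sub>R (f x - s x))"
    using \<eta>_le by (rule birkhoff_bound_mono)
  have "birkhoff_bound M (\<delta> * C * measure M (space M)) (\<lambda>x. (a x - b x) *\<^sub>R s x)"
    using b(2) C \<delta> by (intro birkhoff_bound_uniform) (auto intro!: mult_mono)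
  then have 2: "birkhoff_bound M (\<epsilon> / 2) (\<lambda>x. (a x - b x) *\<^sub>R s x)"
    using \<delta>_le by (rule birkhoff_bound_mono)
  have "birkhoff_bound M \<epsilon> (\<lambda>x. a x *\<^sub>R f x - b x *\<^sub>R s x)"
    using birkhoff_bound_add[OF 1 2] by (simp add: algebra_simps)
  moreover have "simple_function M (\<lambda>x. b x *\<^sub>R s x)"
    using b(1) s(1) by (rule simple_function_compose2)
  then have "(\<lambda>x. b x *\<^sub>R s x) \<in> Bi1 M" using has_Bi1_integral_simple by (auto simp: Bi1_def)
  ultimately show "\<exists>g. g \<in> Bi1 M \<and> birkhoff_bound M \<epsilon> (\<lambda>x. a x *\<^sub>R f x - g x)" by blast
qed

text \<open>
  Up to a small error \<open>f\<close> is a simple function, hence bounded, and the seminorm of a bounded function supported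
  on \<open>A n\<close> is at most a multiple of the measure of \<open>A n\<close>.
\<close>

lemma Bi1_absolutely_continuous:
  assumes f: "f \<in> Bi1 M" and A: "range A \<subseteq> sets M" "decseq A" "(\<Inter>n. A n) = {}" and "0 < \<epsilon>"
  obtains n where "birkhoff_bound M \<epsilon> (\<lambda>x. indicator (A n) x *\<^sub>R f x)"
proof -
  obtain s where s: "simple_function M s" "birkhoff_bound M (\<epsilon> / 4) (\<lambda>x. f x - s x)"
    using Bi1_simple_approximation[OF f, of "\<epsilon> / 4"] \<open>0 < \<epsilon>\<close> by auto
  obtain C where C: "0 \<le> C" "\<And>x. x \<in> space M \<Longrightarrow> norm (s x) \<le> C"
    using simple_function_bounded[OF s(1)] by blast
  have "(\<lambda>n. C * measure M (A n)) \<longlonglongrightarrow> C * measure M (\<Inter>n. A n)"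
    by (intro tendsto_mult_left finite_Lim_measure_decseq A)
  then have "\<forall>\<^sub>F n in sequentially. C * measure M (A n) < \<epsilon> / 2"
    using \<open>0 < \<epsilon>\<close> A(3) by (intro order_tendstoD(2)) auto
  then obtain n where "\<forall>k\<ge>n. C * measure M (A k) < \<epsilon> / 2"
    unfolding eventually_sequentially by (rule exE)
  then have n: "C * measure M (A n) \<le> \<epsilon> / 2" by (simp add: less_imp_le)
  have "birkhoff_bound M (C * measure M (A n)) (\<lambda>x. indicator (A n) x *\<^sub>R s x)"
  proof (rule birkhoff_bound_uniform)
    show "A n \<in> sets M" using A(1) by auto
    then show "norm (indicator (A n) x *\<^sub>R s x) \<le> C" if "x \<in> A n" for x
      using C(2)[of x] that sets.sets_into_space by fastforce
  qed (use C(1) in simp_all)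
  then have "birkhoff_bound M (\<epsilon> / 2) (\<lambda>x. indicator (A n) x *\<^sub>R s x)"
    using n by (rule birkhoff_bound_mono)
  from birkhoff_bound_add[OF birkhoff_bound_indicator[OF s(2), of "A n"] this] show ?thesis
    by (intro that[of n]) (simp add: algebra_simps)
qed

end

section \<open>Strong measurability, restriction, and bounded multipliers\<close>

lemma strongly_measurable_borel:
  assumes "strongly_measurable N f"
  shows "f \<in> borel_measurable N"
proof -
  obtain s where s: "\<forall>n. simple_function N (s n)" "\<forall>x\<in>space N. (\<lambda>n::nat. s n x) \<longlonglongrightarrow> f x"
    using assms unfolding strongly_measurable_def by blast
  show ?thesis
  proof (rule borel_measurable_LIMSEQ_metric)
    show "s n \<in> borel_measurable N" for n using s(1) by (simp add: borel_measurable_simple_function)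
    show "(\<lambda>n. s n x) \<longlonglongrightarrow> f x" if "x \<in> space N" for x using s(2) that by blast
  qed
qed

lemma strongly_measurable_diff:
  assumes "strongly_measurable N f" "strongly_measurable N g"
  shows "strongly_measurable N (\<lambda>x. f x - g x)"
proof -
  obtain s t where "\<forall>n. simple_function N (s n)" "\<forall>x\<in>space N. (\<lambda>n::nat. s n x) \<longlonglongrightarrow> f x"
    and "\<forall>n. simple_function N (t n)" "\<forall>x\<in>space N. (\<lambda>n::nat. t n x) \<longlonglongrightarrow> g x"
    using assms unfolding strongly_measurable_def by blast
  then show ?thesis unfolding strongly_measurable_def
    by (intro exI[of _ "\<lambda>n x. s n x - t n x"]) (simp add: tendsto_diff simple_function_compose2)
qed

lemma strongly_measurable_scaleR:
  fixes a :: "'a \<Rightarrow> real"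
  assumes "a \<in> borel_measurable N" "strongly_measurable N f"
  shows "strongly_measurable N (\<lambda>x. a x *\<^sub>R f x)"
proof -
  obtain s where "\<forall>n. simple_function N (s n)" "\<forall>x\<in>space N. (\<lambda>n::nat. s n x) \<longlonglongrightarrow> f x"
    using assms(2) unfolding strongly_measurable_def by blast
  moreover obtain b where "\<forall>n. simple_function N (b n)" "\<forall>x\<in>space N. (\<lambda>n::nat. b n x) \<longlonglongrightarrow> a x"
    using borel_measurable_implies_sequence_metric[OF assms(1), of 0] by blast
  ultimately show ?thesis unfolding strongly_measurable_def
    by (intro exI[of _ "\<lambda>n x. b n x *\<^sub>R s n x"]) (simp add: tendsto_scaleR simple_function_compose2)
qed

text \<open>
  The values of a sequence of simple functions converging to \<open>f\<close> form a countable set that comes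
  arbitrarily close to every value of \<open>f\<close>; the index \<open>q x\<close> is the first of them close enough to \<open>f x\<close>.
\<close>

lemma strongly_measurable_countable_approximation:
  fixes f :: "'a \<Rightarrow> 'x::banach"
  assumes "strongly_measurable N f" "0 < \<delta>"
  obtains q r where "q \<in> measurable N (count_space (UNIV :: nat set))"
    and "\<And>x. x \<in> space N \<Longrightarrow> norm (f x - r (q x)) \<le> \<delta>"
proof (cases "space N = {}")
  case True
  then show ?thesis by (intro that[of "\<lambda>_. 0"]) auto
next
  case False
  obtain s where s: "\<forall>n. simple_function N (s n)" "\<forall>x\<in>space N. (\<lambda>n::nat. s n x) \<longlonglongrightarrow> f x"
    using assms(1) unfolding strongly_measurable_def by blast
  define Y where "Y = (\<Union>n. s n ` space N)"
  have "countable (s n ` space N)" for n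
    using simple_functionD(1) s(1) by (intro countable_finite) blast
  then have "countable Y" "Y \<noteq> {}"
    using False unfolding Y_def by auto
  then have e: "range (from_nat_into Y) = Y" by (simp add: range_from_nat_into)
  have near: "\<exists>i. norm (f x - from_nat_into Y i) < \<delta>" if "x \<in> space N" for x
  proof -
    have "(\<lambda>n. s n x) \<longlonglongrightarrow> f x" using s(2) that by blast
    from tendstoD[OF this assms(2)] obtain n where "dist (s n x) (f x) < \<delta>"
      by (auto simp: eventually_sequentially)
    moreover have "s n x \<in> range (from_nat_into Y)" using that e by (auto simp: Y_def)
    ultimately show ?thesis by (metis dist_norm dist_commute rangeE)
  qed
  define q where "q x = (LEAST i. norm (f x - from_nat_into Y i) < \<delta>)" for x
  have [measurable]: "(\<lambda>x. norm (f x - y)) \<in> borel_measurable N" for y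
  proof -
    have "(\<lambda>z. norm (z - y)) \<in> borel_measurable borel"
      by (intro borel_measurable_continuous_onI continuous_intros)
    from measurable_compose[OF strongly_measurable_borel[OF assms(1)] this] show ?thesis .
  qed
  have "q \<in> measurable N (count_space UNIV)"
    unfolding q_def by measurable
  moreover have "norm (f x - from_nat_into Y (q x)) \<le> \<delta>" if "x \<in> space N" for x
    using LeastI_ex[OF near[OF that]] by (simp add: q_def)
  ultimately show ?thesis by (rule that)
qed

context finite_measure
begin

lemma birkhoff_bound_restrict_space_iff:
  assumes E: "E \<in> sets M"
  shows "birkhoff_bound (restrict_space M E) c f \<longleftrightarrow> birkhoff_bound M c (\<lambda>x. indicator E x *\<^sub>R f x)"
proof
  have E': "E \<subseteq> space M" "E \<inter> space M = E" using sets.sets_into_space[OF E] by auto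
  have sets_E: "U \<in> sets (restrict_space M E) \<longleftrightarrow> U \<in> sets M \<and> U \<subseteq> E" for U
    using sets_restrict_space_iff[of E M U] E E' by auto
  have meas_E: "measure (restrict_space M E) U = measure M U" if "U \<subseteq> E" for U
    using measure_restrict_space[of E M U] E E' that by simp
  {
    assume "birkhoff_bound (restrict_space M E) c f"
    then obtain p where p: "p \<in> measurable (restrict_space M E) (count_space (UNIV :: nat set))"
      "birkhoff_bound_along (restrict_space M E) p c f"
      unfolding birkhoff_bound_def by blast
    \<comment> \<open>The value \<open>0\<close> marks the complement of \<open>E\<close> as one further cell.\<close>
    define p' where "p' x = (if x \<in> E then Suc (p x) else 0)" for x
    have p': "p' \<in> measurable M (count_space UNIV)"
      unfolding p'_def
    proof (rule measurable_If_restrict_space_iff[THEN iffD2])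
      show "{x \<in> space M. x \<in> E} \<in> sets M" using E' E by (simp add: Int_def conj_commute)
    qed (use p(1) in \<open>auto intro: measurable_compose[OF p(1)] simp: E'(2)\<close>)
    show "birkhoff_bound M c (\<lambda>x. indicator E x *\<^sub>R f x)"
    proof (rule birkhoff_boundI[OF p'])
      fix \<U> \<omega> assume T: "tagged_family M p' \<U> \<omega>"
      define \<V> where "\<V> = {U \<in> \<U>. \<omega> U \<in> E}"
      have V: "U \<subseteq> E \<and> (\<forall>x\<in>U. p x = p (\<omega> U))" if "U \<in> \<V>" for U
      proof -
        have "x \<in> E \<and> p x = p (\<omega> U)" if "x \<in> U" for x
        proof -
          have "U \<in> \<U>" and E: "\<omega> U \<in> E" using \<open>U \<in> \<V>\<close> by (simp_all add: \<V>_def)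
          from tagged_family_const[OF T this(1) that] E show ?thesis
            by (cases "x \<in> E") (simp_all add: p'_def)
        qed
        then show ?thesis by blast
      qed
      have "tagged_family M p' \<V> \<omega>"
        by (rule tagged_family_subset[OF T]) (auto simp: \<V>_def)
      then have \<V>: "finite \<V>" "\<V> \<subseteq> sets M" "disjoint \<V>" "\<forall>U\<in>\<V>. \<omega> U \<in> U"
        unfolding tagged_family_def by blast+
      have "tagged_family (restrict_space M E) p \<V> \<omega>"
        unfolding tagged_family_def
      proof (intro conjI ballI)
        show "\<V> \<subseteq> sets (restrict_space M E)" using V \<V>(2) by (meson sets_E subsetD subsetI)
        show "p x = p (\<omega> U)" if "U \<in> \<V>" "x \<in> U" for U x
          using V[OF that(1)] that(2) by blast
      qed (use \<V> in simp_all)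
      then have "norm (\<Sum>U\<in>\<V>. measure (restrict_space M E) U *\<^sub>R f (\<omega> U)) \<le> c"
        by (rule birkhoff_bound_alongD[OF p(2)])
      also have "(\<Sum>U\<in>\<V>. measure (restrict_space M E) U *\<^sub>R f (\<omega> U)) =
          (\<Sum>U\<in>\<V>. measure M U *\<^sub>R (indicator E (\<omega> U) *\<^sub>R f (\<omega> U)))"
        using V meas_E by (intro sum.cong) (auto simp: \<V>_def)
      also have "\<dots> = (\<Sum>U\<in>\<U>. measure M U *\<^sub>R (indicator E (\<omega> U) *\<^sub>R f (\<omega> U)))"
        using T unfolding tagged_family_def \<V>_def by (intro sum.mono_neutral_left) auto
      finally show "norm (\<Sum>U\<in>\<U>. measure M U *\<^sub>R (indicator E (\<omega> U) *\<^sub>R f (\<omega> U))) \<le> c" .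
    qed
  next
    assume "birkhoff_bound M c (\<lambda>x. indicator E x *\<^sub>R f x)"
    then obtain p where p: "p \<in> measurable M (count_space (UNIV :: nat set))"
      "birkhoff_bound_along M p c (\<lambda>x. indicator E x *\<^sub>R f x)"
      unfolding birkhoff_bound_def by blast
    show "birkhoff_bound (restrict_space M E) c f"
    proof (rule birkhoff_boundI)
      show "p \<in> measurable (restrict_space M E) (count_space (UNIV :: nat set))"
        using p(1) by (rule measurable_restrict_space1)
      fix \<U> \<omega> assume T: "tagged_family (restrict_space M E) p \<U> \<omega>"
      then have \<U>: "finite \<U>" "\<U> \<subseteq> sets (restrict_space M E)" "disjoint \<U>" "\<forall>U\<in>\<U>. \<omega> U \<in> U"
        unfolding tagged_family_def by blast+
      have sub: "U \<subseteq> E" "\<omega> U \<in> E" "U \<in> sets M" if "U \<in> \<U>" for U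
        using sets_E[of U] \<U>(2,4) that by auto
      have "tagged_family M p \<U> \<omega>"
        unfolding tagged_family_def
      proof (intro conjI ballI)
        show "p x = p (\<omega> U)" if "U \<in> \<U>" "x \<in> U" for U x
          by (rule tagged_family_const[OF T that])
      qed (use \<U> sub in auto)
      then have "norm (\<Sum>U\<in>\<U>. measure M U *\<^sub>R (indicator E (\<omega> U) *\<^sub>R f (\<omega> U))) \<le> c"
        by (rule birkhoff_bound_alongD[OF p(2)])
      also have "(\<Sum>U\<in>\<U>. measure M U *\<^sub>R (indicator E (\<omega> U) *\<^sub>R f (\<omega> U))) =
          (\<Sum>U\<in>\<U>. measure (restrict_space M E) U *\<^sub>R f (\<omega> U))"
        using sub meas_E by (intro sum.cong) auto
      finally show "norm (\<Sum>U\<in>\<U>. measure (restrict_space M E) U *\<^sub>R f (\<omega> U)) \<le> c" .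
    qed
  }
qed

text \<open>
  Integrals over subsets become integrals of one measure, so that all integrals in the definition of
  conditional expectation can be compared by linearity.
\<close>

lemma has_Bi1_integral_on_iff_indicator:
  assumes E: "E \<in> sets M"
  shows "has_Bi1_integral_on M E f J \<longleftrightarrow> has_Bi1_integral M (\<lambda>x. indicator E x *\<^sub>R f x) J"
proof -
  interpret R: finite_measure "restrict_space M E"
    using finite_measure_restrict_space[OF finite_measure_axioms E] .
  have E': "E \<inter> space M \<in> sets M" "E \<subseteq> space M" using sets.sets_into_space[OF E] E by auto
  have simple: "simple_function (restrict_space M E) s \<longleftrightarrow> simple_function M (\<lambda>x. indicator E x *\<^sub>R s x)"
    for s :: "'a \<Rightarrow> 'b" using simple_function_restrict_space[OF E'(1)] .
  have int: "simple_int (restrict_space M E) s = simple_int M (\<lambda>x. indicator E x *\<^sub>R s x)"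
    if "simple_function (restrict_space M E) s" for s :: "'a \<Rightarrow> 'b"
    using simple_bochner_integral_restrict_space[OF E'(1) R.simple_bochner_integrable_if_simple[OF that]] .
  show ?thesis
    unfolding has_Bi1_integral_on_def
  proof
    assume *: "has_Bi1_integral (restrict_space M E) f J"
    show "has_Bi1_integral M (\<lambda>x. indicator E x *\<^sub>R f x) J"
    proof (rule has_Bi1_integralI_simple_approximation)
      fix \<epsilon> :: real assume "0 < \<epsilon>"
      then obtain s where s: "simple_function (restrict_space M E) s"
        "birkhoff_bound (restrict_space M E) \<epsilon> (\<lambda>x. f x - s x)"
        "norm (simple_int (restrict_space M E) s - J) \<le> \<epsilon>"
        by (rule R.has_Bi1_integral_imp_simple_approximation[OF *])
      have "birkhoff_bound M \<epsilon> (\<lambda>x. indicator E x *\<^sub>R f x - indicator E x *\<^sub>R s x)"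
        using s(2) by (simp add: birkhoff_bound_restrict_space_iff[OF E] scaleR_diff_right)
      then show "\<exists>t. simple_function M t \<and> birkhoff_bound M \<epsilon> (\<lambda>x. indicator E x *\<^sub>R f x - t x) \<and>
          norm (simple_int M t - J) \<le> \<epsilon>"
        using s simple int[OF s(1)] by (intro exI[of _ "\<lambda>x. indicator E x *\<^sub>R s x"]) simp
    qed
  next
    assume *: "has_Bi1_integral M (\<lambda>x. indicator E x *\<^sub>R f x) J"
    show "has_Bi1_integral (restrict_space M E) f J"
    proof (rule R.has_Bi1_integralI_simple_approximation)
      fix \<epsilon> :: real assume "0 < \<epsilon>"
      then obtain s where s: "simple_function M s"
        "birkhoff_bound M (\<epsilon> / 4) (\<lambda>x. indicator E x *\<^sub>R f x - s x)" "norm (simple_int M s - J) \<le> \<epsilon> / 4"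
        using has_Bi1_integral_imp_simple_approximation[OF *, of "\<epsilon> / 4"] by auto
      let ?t = "\<lambda>x. indicator E x *\<^sub>R s x"
      have t: "simple_function M ?t"
        using E s(1) by (intro simple_function_compose2[where h = "(*\<^sub>R)"]) auto
      have bt: "birkhoff_bound M (\<epsilon> / 2) (\<lambda>x. indicator E x *\<^sub>R (f x - s x))"
        using birkhoff_bound_indicator[OF s(2), of E]
        by (rule birkhoff_bound_cong[OF birkhoff_bound_mono]) (auto simp: indicator_def)
      have "birkhoff_bound M (\<epsilon> / 4 + \<epsilon> / 2) (\<lambda>x. ?t x - s x)"
        by (rule birkhoff_bound_cong[OF birkhoff_bound_diff[OF s(2) bt]]) (simp add: algebra_simps)
      then have "norm (simple_int M ?t - simple_int M s) \<le> \<epsilon> / 4 + \<epsilon> / 2"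
        by (rule norm_Bi1_integral_le[OF has_Bi1_integral_diff[OF has_Bi1_integral_simple[OF t] has_Bi1_integral_simple[OF s(1)]]])
      from norm_triangle_mono[OF this s(3)] have "norm (simple_int M ?t - J) \<le> \<epsilon>" by simp
      moreover have "birkhoff_bound (restrict_space M E) \<epsilon> (\<lambda>x. f x - s x)"
        unfolding birkhoff_bound_restrict_space_iff[OF E]
        by (rule birkhoff_bound_mono[OF bt]) (use \<open>0 < \<epsilon>\<close> in simp)
      ultimately show "\<exists>s. simple_function (restrict_space M E) s \<and>
          birkhoff_bound (restrict_space M E) \<epsilon> (\<lambda>x. f x - s x) \<and>
          norm (simple_int (restrict_space M E) s - J) \<le> \<epsilon>"
        using t simple int[of s] by (intro exI[of _ s]) simp
    qed
  qed
qed

text \<open>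
  For simple \<open>a\<close> this is linearity; a bounded \<open>a\<close> is a uniform limit of simple functions on \<open>F\<close>, and
  multiplying \<open>h\<close> by a uniformly small function gives a function of small seminorm.
\<close>

lemma has_Bi1_integral_mult_eq_zero:
  assumes sub: "subalgebra M F"
    and zero: "\<And>E. E \<in> sets F \<Longrightarrow> has_Bi1_integral M (\<lambda>x. indicator E x *\<^sub>R h x) 0"
    and a: "a \<in> borel_measurable F" "\<And>x. x \<in> space M \<Longrightarrow> \<bar>a x\<bar> \<le> K"
  shows "has_Bi1_integral M (\<lambda>x. a x *\<^sub>R h x) 0"
proof -
  have spF: "space F = space M" using sub by (simp add: subalgebra_def)
  have "has_Bi1_integral M h 0"
    using zero[OF sets.top] by (rule has_Bi1_integral_cong) (simp add: spF)
  then obtain C where C: "birkhoff_bound M C h" using Bi1_birkhoff_bounded[of h] by (auto simp: Bi1_def)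
  show ?thesis
  proof (rule has_Bi1_integral_approx)
    fix \<epsilon> :: real assume "0 < \<epsilon>"
    define \<delta> where "\<delta> = \<epsilon> / (2 * C + 1)"
    have "0 \<le> C" using C by (rule birkhoff_bound_nonneg)
    then have \<delta>: "0 < \<delta>" "2 * \<delta> * C \<le> \<epsilon>" using \<open>0 < \<epsilon>\<close> by (simp_all add: \<delta>_def field_simps)
    obtain b where b: "simple_function F b" "\<And>x. x \<in> space F \<Longrightarrow> \<bar>a x - b x\<bar> \<le> \<delta>"
      using bounded_measurable_simple_approximation[OF a(1) _ \<delta>(1), of K] a(2) spF by auto
    let ?L = "\<lambda>y. {x \<in> space F. b x = y}"
    have L: "?L y \<in> sets F" for y
      using simple_functionD(2)[OF b(1), of "{y}"] by (simp add: vimage_def Int_def conj_commute)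
    have "has_Bi1_integral M (\<lambda>x. \<Sum>y\<in>b ` space F. y *\<^sub>R (indicator (?L y) x *\<^sub>R h x)) (\<Sum>y\<in>b ` space F. y *\<^sub>R 0)"
      using simple_functionD(1)[OF b(1)] by (intro has_Bi1_integral_sum has_Bi1_integral_scaleR zero L)
    then have "has_Bi1_integral M (\<lambda>x. b x *\<^sub>R h x) (\<Sum>y\<in>b ` space F. y *\<^sub>R 0)"
    proof (rule has_Bi1_integral_cong)
      fix x assume x: "x \<in> space M"
      have "(\<Sum>y\<in>b ` space F. y *\<^sub>R (indicator (?L y) x *\<^sub>R h x)) = (\<Sum>y\<in>b ` space F. if y = b x then y *\<^sub>R h x else 0)"
        using x spF by (intro sum.cong) (auto simp: indicator_def)
      also have "\<dots> = b x *\<^sub>R h x"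
        using x spF simple_functionD(1)[OF b(1)] by (simp add: sum.delta)
      finally show "(\<Sum>y\<in>b ` space F. y *\<^sub>R (indicator (?L y) x *\<^sub>R h x)) = b x *\<^sub>R h x" .
    qed
    then have 1: "has_Bi1_integral M (\<lambda>x. b x *\<^sub>R h x) 0" by simp
    have "birkhoff_bound M (2 * \<delta> * C) (\<lambda>x. (a x - b x) *\<^sub>R h x)"
      using b(2) \<delta>(1) spF by (intro birkhoff_bound_mult[OF C]) auto
    then have "birkhoff_bound M \<epsilon> (\<lambda>x. a x *\<^sub>R h x - b x *\<^sub>R h x)"
      using birkhoff_bound_mono[OF _ \<delta>(2)] by (simp add: scaleR_diff_left)
    with 1 show "\<exists>g K. has_Bi1_integral M g K \<and> birkhoff_bound M \<epsilon> (\<lambda>x. a x *\<^sub>R h x - g x) \<and> norm (K - 0) \<le> \<epsilon>"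
      using \<open>0 < \<epsilon>\<close> by (intro exI[of _ "\<lambda>x. b x *\<^sub>R h x"] exI[of _ 0]) simp
  qed
qed

section \<open>Pulling out an unbounded multiplier\<close>

text \<open>
  A function \<open>g\<close> that is strongly measurable for \<open>F\<close> is nearly constant on the cells of a countable
  partition of the space into sets of \<open>F\<close>. Its sum over a finer tagged family is therefore close to the integral
  of \<open>c * g\<close>, where \<open>c\<close> is constant on each cell, namely the fraction of the cell that the family
  fills. Such a \<open>c\<close> is measurable for \<open>F\<close> even though the members of the family need not be in \<open>F\<close>; so
  its integral can be computed with \<open>f\<close> in place of \<open>g\<close>, and it is at most twice the seminorm of \<open>f\<close>. Since the
  family is finite, \<open>c\<close> vanishes off finitely many cells, which is why the
  hypothesis is restricted to weights supported on finitely many fibres of \<open>p0\<close>.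
\<close>

lemma birkhoff_bound_transfer:
  assumes sub: "subalgebra M F"
    and f: "birkhoff_bound M \<epsilon> f" and g: "strongly_measurable F g"
    and p0: "p0 \<in> measurable F (count_space (UNIV :: nat set))"
    and transfer: "\<And>c N. c \<in> borel_measurable F \<Longrightarrow> (\<And>x. x \<in> space M \<Longrightarrow> 0 \<le> c x \<and> c x \<le> 1) \<Longrightarrow>
      finite N \<Longrightarrow> (\<And>x. x \<in> space M \<Longrightarrow> c x \<noteq> 0 \<Longrightarrow> p0 x \<in> N) \<Longrightarrow>
      \<exists>K. has_Bi1_integral M (\<lambda>x. c x *\<^sub>R f x) K \<and> has_Bi1_integral M (\<lambda>x. c x *\<^sub>R g x) K"
    and "0 < \<delta>"
  shows "birkhoff_bound M (2 * \<epsilon> + 2 * \<delta> * measure M (space M)) g"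
proof -
  have spF: "space F = space M" and setsF: "sets F \<subseteq> sets M" using sub by (auto simp: subalgebra_def)
  obtain q r where q: "q \<in> measurable F (count_space (UNIV :: nat set))"
    and r: "\<And>x. x \<in> space F \<Longrightarrow> norm (g x - r (q x)) \<le> \<delta>"
    using strongly_measurable_countable_approximation[OF g \<open>0 < \<delta>\<close>] by blast
  define p where "p x = prod_encode (p0 x, q x)" for x
  have pF: "p \<in> measurable F (count_space UNIV)"
    unfolding p_def using p0 q by (rule measurable_prod_encode)
  note [measurable] = pF
  define \<rho> where "\<rho> i = r (snd (prod_decode i))" for i
  have \<rho>: "norm (g x - \<rho> (p x)) \<le> \<delta>" if "x \<in> space M" for x
    using r that by (simp add: \<rho>_def p_def spF)
  define D where "D i = {x \<in> space F. p x = i}" for i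
  have D_F: "D i \<in> sets F" for i unfolding D_def by measurable
  then have D: "D i \<in> sets M" for i using setsF by blast
  show ?thesis
  proof (rule birkhoff_boundI[OF measurable_from_subalg[OF sub pF]])
    fix \<U> \<omega> assume T: "tagged_family M p \<U> \<omega>"
    then have fin: "finite \<U>" and sets: "\<U> \<subseteq> sets M" and disj: "disjoint \<U>"
      unfolding tagged_family_def by blast+
    let ?V = "\<lambda>i. {U \<in> \<U>. p (\<omega> U) = i}"
    define I where "I = (\<lambda>U. p (\<omega> U)) ` \<U>"
    define m where "m i = (\<Sum>U\<in>?V i. measure M U)" for i
    have m0: "0 \<le> m i" for i unfolding m_def by (rule sum_nonneg) simp
    have sum_measure: "(\<Sum>U\<in>\<V>. measure M U) \<le> measure M A"
      if "\<V> \<subseteq> \<U>" "\<And>U. U \<in> \<V> \<Longrightarrow> U \<subseteq> A" "A \<in> sets M" for \<V> A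
    proof -
      have "finite \<V>" "\<V> \<subseteq> sets M" "disjoint \<V>"
        using that(1) fin sets disj by (auto intro: finite_subset pairwise_subset)
      then have "(\<Sum>U\<in>\<V>. measure M U) = measure M (\<Union>\<V>)"
        by (subst measure_Union') (auto simp: fmeasurable_eq_sets pairwise_def)
      also have "\<dots> \<le> measure M A" using that by (intro finite_measure_mono) auto
      finally show ?thesis .
    qed
    have m_le: "m i \<le> measure M (D i)" for i
      unfolding m_def
    proof (rule sum_measure)
      show "U \<subseteq> D i" if "U \<in> ?V i" for U
      proof
        fix x assume "x \<in> U"
        have "U \<in> \<U>" "p (\<omega> U) = i" using that by simp_all
        then show "x \<in> D i"
          using tagged_family_const[OF T \<open>U \<in> \<U>\<close> \<open>x \<in> U\<close>] \<open>x \<in> U\<close> sets sets.sets_into_space[of U M]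
          by (auto simp: D_def spF)
      qed
    qed (use D in auto)
    \<comment> \<open>On null cells the quotient is \<open>0\<close>, and so is \<open>m i\<close>.\<close>
    define C where "C i = m i / measure M (D i)" for i
    have C: "0 \<le> C i" "C i \<le> 1" for i
      using m0[of i] m_le[of i] by (auto simp: C_def divide_le_eq_1)
    have Cm: "measure M (D i) * C i = m i" for i
      using m0[of i] m_le[of i] by (simp add: C_def)
    have C_zero: "C i = 0" if "i \<notin> I" for i
    proof -
      have "?V i = {}" using that by (auto simp: I_def)
      then show ?thesis unfolding C_def m_def by (simp only: sum.empty div_0)
    qed
    have finI: "finite I" using fin by (simp add: I_def)
    have "\<exists>K. has_Bi1_integral M (\<lambda>x. C (p x) *\<^sub>R f x) K \<and> has_Bi1_integral M (\<lambda>x. C (p x) *\<^sub>R g x) K"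
    proof (rule transfer)
      show "(\<lambda>x. C (p x)) \<in> borel_measurable F" by measurable
      show "finite ((\<lambda>i. fst (prod_decode i)) ` I)" using finI by simp
      show "p0 x \<in> (\<lambda>i. fst (prod_decode i)) ` I" if "C (p x) \<noteq> 0" for x
      proof (rule image_eqI)
        show "p x \<in> I" using that C_zero by blast
      qed (simp add: p_def)
    qed (use C in simp)
    then obtain K where Kf: "has_Bi1_integral M (\<lambda>x. C (p x) *\<^sub>R f x) K"
      and Kg: "has_Bi1_integral M (\<lambda>x. C (p x) *\<^sub>R g x) K" by blast
    have "birkhoff_bound M (2 * 1 * \<epsilon>) (\<lambda>x. C (p x) *\<^sub>R f x)"
      by (rule birkhoff_bound_mult[OF f]) (use C in simp_all)
    then have K: "norm K \<le> 2 * \<epsilon>" using norm_Bi1_integral_le[OF Kf] by simp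
    define T' where "T' = (\<Sum>i\<in>I. measure M (D i) *\<^sub>R (C i *\<^sub>R \<rho> i))"
    have "has_Bi1_integral M (\<lambda>x. \<Sum>i\<in>I. indicator (D i) x *\<^sub>R (C i *\<^sub>R \<rho> i)) T'"
      unfolding T'_def by (intro has_Bi1_integral_sum finI has_Bi1_integral_indicator D)
    then have int_T': "has_Bi1_integral M (\<lambda>x. C (p x) *\<^sub>R \<rho> (p x)) T'"
    proof (rule has_Bi1_integral_cong)
      fix x assume "x \<in> space M"
      then have "(\<Sum>i\<in>I. indicator (D i) x *\<^sub>R (C i *\<^sub>R \<rho> i)) = (\<Sum>i\<in>I. if i = p x then C i *\<^sub>R \<rho> i else 0)"
        by (intro sum.cong) (auto simp: D_def spF indicator_def)
      also have "\<dots> = C (p x) *\<^sub>R \<rho> (p x)" using finI C_zero by (simp add: sum.delta)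
      finally show "(\<Sum>i\<in>I. indicator (D i) x *\<^sub>R (C i *\<^sub>R \<rho> i)) = C (p x) *\<^sub>R \<rho> (p x)" .
    qed
    have "birkhoff_bound M (\<delta> * measure M (space M)) (\<lambda>x. C (p x) *\<^sub>R g x - C (p x) *\<^sub>R \<rho> (p x))"
    proof (rule birkhoff_bound_uniform)
      fix x assume "x \<in> space M"
      then have "C (p x) * norm (g x - \<rho> (p x)) \<le> 1 * \<delta>"
        using C \<rho> by (intro mult_mono) auto
      then show "norm (C (p x) *\<^sub>R g x - C (p x) *\<^sub>R \<rho> (p x)) \<le> \<delta>"
        using C by (simp add: scaleR_diff_right[symmetric])
    qed (use \<open>0 < \<delta>\<close> in simp_all)
    then have KT: "norm (K - T') \<le> \<delta> * measure M (space M)"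
      by (rule norm_Bi1_integral_le[OF has_Bi1_integral_diff[OF Kg int_T']])
    have "(\<Sum>U\<in>\<U>. measure M U *\<^sub>R \<rho> (p (\<omega> U))) = (\<Sum>i\<in>I. \<Sum>U\<in>?V i. measure M U *\<^sub>R \<rho> (p (\<omega> U)))"
      unfolding I_def by (rule sum.image_gen[OF fin])
    also have "\<dots> = T'"
      unfolding T'_def by (intro sum.cong refl) (simp add: Cm m_def scaleR_sum_left)
    finally have T'_eq: "(\<Sum>U\<in>\<U>. measure M U *\<^sub>R \<rho> (p (\<omega> U))) = T'" .
    let ?S = "\<Sum>U\<in>\<U>. measure M U *\<^sub>R g (\<omega> U)"
    have "?S - T' = (\<Sum>U\<in>\<U>. measure M U *\<^sub>R (g (\<omega> U) - \<rho> (p (\<omega> U))))"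
      unfolding T'_eq[symmetric] by (simp add: scaleR_diff_right sum_subtractf)
    also have "norm \<dots> \<le> (\<Sum>U\<in>\<U>. measure M U * \<delta>)"
      using \<rho> tagged_family_tag_in_space[OF T] by (intro sum_norm_le) (auto intro!: mult_left_mono)
    also have "\<dots> = \<delta> * (\<Sum>U\<in>\<U>. measure M U)" by (simp add: sum_distrib_left mult.commute)
    also have "\<dots> \<le> \<delta> * measure M (space M)"
      using \<open>0 < \<delta>\<close> sets sets.sets_into_space by (intro mult_left_mono sum_measure) auto
    finally have ST: "norm (?S - T') \<le> \<delta> * measure M (space M)" .
    have "norm ?S \<le> norm K + norm (?S - K)" by (rule norm_triangle_sub)
    moreover have "norm (?S - K) \<le> norm (?S - T') + norm (K - T')"
      using norm_triangle_ineq4[of "?S - T'" "K - T'"] by simp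
    ultimately show "norm ?S \<le> 2 * \<epsilon> + 2 * \<delta> * measure M (space M)"
      using ST KT K by linarith
  qed
qed

text \<open>
  Where \<open>\<phi>\<close> is bounded, \<open>\<phi> * (\<Phi> - \<Psi>)\<close> has integral zero. The set where \<open>\<bar>\<phi>\<bar>\<close> is at least \<open>n\<close> contributes
  little to \<open>\<phi> * \<Phi>\<close> for large \<open>n\<close>, and the smallness is inherited by \<open>\<phi> * \<Psi>\<close>: the weights occurring in
  the transfer lemma live on finitely many level sets of \<open>\<lfloor>\<bar>\<phi>\<bar>\<rfloor>\<close>, on which \<open>\<phi>\<close> is bounded.
\<close>

lemma has_Bi1_integral_pull_out:
  fixes \<Phi> \<Psi> :: "'a \<Rightarrow> 'x::banach" and \<phi> :: "'a \<Rightarrow> real"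
  assumes sub: "subalgebra M F" and \<Psi>: "strongly_measurable F \<Psi>"
    and eq: "\<And>E. E \<in> sets F \<Longrightarrow> has_Bi1_integral M (\<lambda>x. indicator E x *\<^sub>R (\<Phi> x - \<Psi> x)) 0"
    and \<phi>: "\<phi> \<in> borel_measurable F"
    and J: "has_Bi1_integral M (\<lambda>x. \<phi> x *\<^sub>R \<Phi> x) J"
  shows "has_Bi1_integral M (\<lambda>x. \<phi> x *\<^sub>R \<Psi> x) J"
proof (rule has_Bi1_integral_approx)
  fix \<epsilon> :: real assume "0 < \<epsilon>"
  have spF: "space F = space M" using sub by (simp add: subalgebra_def)
  note [measurable] = \<phi>
  let ?f = "\<lambda>x. \<phi> x *\<^sub>R \<Phi> x"
  have f: "?f \<in> Bi1 M" using J by (auto simp: Bi1_def)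
  have bounded_part: "has_Bi1_integral M (\<lambda>x. (a x * \<phi> x) *\<^sub>R \<Psi> x) K"
    if a: "a \<in> borel_measurable F" and b: "\<And>x. x \<in> space M \<Longrightarrow> \<bar>a x * \<phi> x\<bar> \<le> B"
      and K: "has_Bi1_integral M (\<lambda>x. a x *\<^sub>R ?f x) K" for a B K
  proof -
    have "has_Bi1_integral M (\<lambda>x. (a x * \<phi> x) *\<^sub>R (\<Phi> x - \<Psi> x)) 0"
      by (rule has_Bi1_integral_mult_eq_zero[OF sub eq borel_measurable_times[OF a \<phi>] b])
    from has_Bi1_integral_diff[OF K this] show ?thesis by (simp add: algebra_simps)
  qed
  define p0 where "p0 x = nat \<lfloor>\<bar>\<phi> x\<bar>\<rfloor>" for x
  have p0: "p0 \<in> measurable F (count_space UNIV)" unfolding p0_def by measurable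
  have \<phi>_le: "\<bar>\<phi> x\<bar> \<le> real (p0 x) + 1" for x unfolding p0_def by linarith
  define A where "A n = {x \<in> space F. real n \<le> \<bar>\<phi> x\<bar>}" for n
  have A_F [measurable]: "A n \<in> sets F" for n unfolding A_def by measurable
  have A: "range A \<subseteq> sets M" using A_F sub by (auto simp: subalgebra_def)
  have A_dec: "decseq A" by (auto simp: decseq_def A_def)
  have "\<exists>n. x \<notin> A n" for x using reals_Archimedean2[of "\<bar>\<phi> x\<bar>"] by (auto simp: A_def not_le)
  then have A_empty: "(\<Inter>n. A n) = {}" by blast
  have "0 < \<epsilon> / 3" using \<open>0 < \<epsilon>\<close> by simp
  then obtain n where n: "birkhoff_bound M (\<epsilon> / 3) (\<lambda>x. indicator (A n) x *\<^sub>R ?f x)"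
    by (rule Bi1_absolutely_continuous[OF f A A_dec A_empty])
  have mult: "\<exists>K. has_Bi1_integral M (\<lambda>x. a x *\<^sub>R ?f x) K"
    if "a \<in> borel_measurable F" "\<And>x. x \<in> space M \<Longrightarrow> \<bar>a x\<bar> \<le> 1" for a
    using Bi1_mult_bounded[OF f measurable_from_subalg[OF sub that(1)] that(2)] by (simp add: Bi1_def)
  define \<delta> where "\<delta> = \<epsilon> / (6 * (measure M (space M) + 1))"
  have \<delta>: "0 < \<delta>" using \<open>0 < \<epsilon>\<close> by (simp add: \<delta>_def add_nonneg_pos)
  have \<delta>_le: "2 * \<delta> * measure M (space M) \<le> \<epsilon> / 3"
    using \<open>0 < \<epsilon>\<close> add_nonneg_pos[of "measure M (space M)" 1] by (simp add: \<delta>_def field_simps)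
  have "birkhoff_bound M (2 * (\<epsilon> / 3) + 2 * \<delta> * measure M (space M)) (\<lambda>x. (indicator (A n) x * \<phi> x) *\<^sub>R \<Psi> x)"
  proof (rule birkhoff_bound_transfer[OF sub n _ p0 _ \<delta>])
    show "strongly_measurable F (\<lambda>x. (indicator (A n) x * \<phi> x) *\<^sub>R \<Psi> x)"
      by (rule strongly_measurable_scaleR[OF _ \<Psi>]) measurable
  next
    fix c :: "'a \<Rightarrow> real" and N
    assume c [measurable]: "c \<in> borel_measurable F" and c01: "\<And>x. x \<in> space M \<Longrightarrow> 0 \<le> c x \<and> c x \<le> 1"
      and N: "finite N" "\<And>x. x \<in> space M \<Longrightarrow> c x \<noteq> 0 \<Longrightarrow> p0 x \<in> N"
    let ?a = "\<lambda>x. c x * indicator (A n) x"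
    have a: "?a \<in> borel_measurable F" by measurable
    obtain K where K: "has_Bi1_integral M (\<lambda>x. ?a x *\<^sub>R ?f x) K"
      using mult[OF a] c01 by (fastforce simp: indicator_def)
    have "has_Bi1_integral M (\<lambda>x. (?a x * \<phi> x) *\<^sub>R \<Psi> x) K"
    proof (rule bounded_part[OF a _ K])
      fix x assume x: "x \<in> space M"
      show "\<bar>?a x * \<phi> x\<bar> \<le> real (Max N) + 1"
      proof (cases "c x = 0")
        case False
        then have "p0 x \<le> Max N" using N x by simp
        then have "\<bar>\<phi> x\<bar> \<le> real (Max N) + 1" using \<phi>_le[of x] by linarith
        moreover have "\<bar>?a x\<bar> \<le> 1" using c01[OF x] by (simp add: indicator_def)
        ultimately have "\<bar>?a x\<bar> * \<bar>\<phi> x\<bar> \<le> 1 * (real (Max N) + 1)" by (intro mult_mono) auto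
        then show ?thesis by (simp add: abs_mult)
      qed simp
    qed
    with K show "\<exists>K. has_Bi1_integral M (\<lambda>x. c x *\<^sub>R (indicator (A n) x *\<^sub>R ?f x)) K \<and>
        has_Bi1_integral M (\<lambda>x. c x *\<^sub>R ((indicator (A n) x * \<phi> x) *\<^sub>R \<Psi> x)) K"
      by (intro exI[of _ K]) (simp add: mult.assoc)
  qed
  then have tail: "birkhoff_bound M \<epsilon> (\<lambda>x. (indicator (A n) x * \<phi> x) *\<^sub>R \<Psi> x)"
    by (rule birkhoff_bound_mono) (use \<delta>_le in simp)
  let ?b = "\<lambda>x. 1 - indicator (A n) x :: real"
  have b: "?b \<in> borel_measurable F" by measurable
  obtain K where K: "has_Bi1_integral M (\<lambda>x. ?b x *\<^sub>R ?f x) K"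
    using mult[OF b] by (fastforce simp: indicator_def)
  have "has_Bi1_integral M (\<lambda>x. (?b x * \<phi> x) *\<^sub>R \<Psi> x) K"
    by (rule bounded_part[OF b _ K, of "real n"]) (auto simp: indicator_def A_def spF)
  moreover have "birkhoff_bound M \<epsilon> (\<lambda>x. \<phi> x *\<^sub>R \<Psi> x - (?b x * \<phi> x) *\<^sub>R \<Psi> x)"
    using tail by (simp add: algebra_simps)
  moreover have "norm (K - J) \<le> \<epsilon>"
  proof -
    have "has_Bi1_integral M (\<lambda>x. indicator (A n) x *\<^sub>R ?f x) (J - K)"
      by (rule has_Bi1_integral_cong[OF has_Bi1_integral_diff[OF J K]]) (simp add: algebra_simps)
    from norm_Bi1_integral_le[OF this n] show ?thesis
      using \<open>0 < \<epsilon>\<close> by (simp add: norm_minus_commute)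
  qed
  ultimately show "\<exists>g K. has_Bi1_integral M g K \<and> birkhoff_bound M \<epsilon> (\<lambda>x. \<phi> x *\<^sub>R \<Psi> x - g x) \<and> norm (K - J) \<le> \<epsilon>"
    by (intro exI conjI)
qed

text \<open>
  On a set of \<open>F\<close> where \<open>h\<close> stays within \<open>\<delta>\<close> of a vector \<open>r\<close>, the integral zero differs from the measure times
  \<open>r\<close> by at most \<open>\<delta>\<close> times the measure. So \<open>r\<close> has norm at most \<open>\<delta>\<close> unless the set is null.
\<close>

lemma AE_zero_if_Bi1_integrals_zero:
  fixes h :: "'a \<Rightarrow> 'x::banach"
  assumes sub: "subalgebra M F" and h: "strongly_measurable F h"
    and zero: "\<And>E. E \<in> sets F \<Longrightarrow> has_Bi1_integral M (\<lambda>x. indicator E x *\<^sub>R h x) 0"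
  shows "AE x in M. h x = 0"
proof -
  have spF: "space F = space M" and setsF: "sets F \<subseteq> sets M" using sub by (auto simp: subalgebra_def)
  have small: "AE x in M. norm (h x) \<le> 2 * \<delta>" if "0 < \<delta>" for \<delta>
  proof -
    obtain q r where q: "q \<in> measurable F (count_space (UNIV :: nat set))"
      and r: "\<And>x. x \<in> space F \<Longrightarrow> norm (h x - r (q x)) \<le> \<delta>"
      using strongly_measurable_countable_approximation[OF h \<open>0 < \<delta>\<close>] by blast
    note [measurable] = q
    define D where "D i = {x \<in> space F. q x = i}" for i
    have D_F: "D i \<in> sets F" for i unfolding D_def by measurable
    then have D: "D i \<in> sets M" for i using setsF by blast
    have r_small: "norm (r i) \<le> \<delta>" if "measure M (D i) \<noteq> 0" for i
    proof -
      have "has_Bi1_integral M (\<lambda>x. indicator (D i) x *\<^sub>R h x - indicator (D i) x *\<^sub>R r i) (0 - measure M (D i) *\<^sub>R r i)"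
        by (intro has_Bi1_integral_diff zero D_F has_Bi1_integral_indicator D)
      moreover have "birkhoff_bound M (\<delta> * measure M (D i)) (\<lambda>x. indicator (D i) x *\<^sub>R h x - indicator (D i) x *\<^sub>R r i)"
        using D r \<open>0 < \<delta>\<close> by (intro birkhoff_bound_uniform) (auto simp: D_def)
      ultimately have "norm (0 - measure M (D i) *\<^sub>R r i) \<le> \<delta> * measure M (D i)"
        by (rule norm_Bi1_integral_le)
      then have "norm (r i) * measure M (D i) \<le> \<delta> * measure M (D i)" by (simp add: mult.commute)
      moreover have "0 < measure M (D i)" using that by (simp add: zero_less_measure_iff)
      ultimately show ?thesis by (rule mult_right_le_imp_le)
    qed
    have "AE x in M. x \<notin> D i" if "measure M (D i) = 0" for i
      using that D by (intro AE_not_in) (auto simp: null_sets_def emeasure_eq_measure)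
    then have "AE x in M. \<forall>i. measure M (D i) = 0 \<longrightarrow> x \<notin> D i"
      by (simp add: AE_all_countable)
    with AE_space show ?thesis
    proof eventually_elim
      case (elim x)
      then have "measure M (D (q x)) \<noteq> 0" by (auto simp: D_def spF)
      then have "norm (r (q x)) \<le> \<delta>" by (rule r_small)
      moreover have "norm (h x - r (q x)) \<le> \<delta>" using r elim(1) spF by simp
      moreover have "norm (h x) \<le> norm (r (q x)) + norm (h x - r (q x))" by (rule norm_triangle_sub)
      ultimately show ?case by linarith
    qed
  qed
  have "AE x in M. \<forall>n. norm (h x) \<le> 2 * inverse (real (Suc n))"
    unfolding AE_all_countable by (intro allI small) simp
  then show ?thesis
  proof eventually_elim
    case (elim x)
    have "(\<lambda>n. 2 * inverse (real (Suc n))) \<longlonglongrightarrow> 2 * 0"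
      by (intro tendsto_mult_left LIMSEQ_inverse_real_of_nat)
    then have "norm (h x) \<le> 2 * 0" by (rule LIMSEQ_le_const) (use elim in blast)
    then show ?case by simp
  qed
qed

end

theorem theorem2p13:
  fixes M F :: "'a measure" and \<Phi> \<Psi> :: "'a \<Rightarrow> 'x::banach" and \<phi> :: "'a \<Rightarrow> real"
  assumes "finite_measure M"
    and "subalgebra M F"
    and "strongly_measurable M \<Phi>"
    and "is_cond_exp M F \<Phi> \<Psi>"
    and "\<phi> \<in> borel_measurable F"
    and "(\<lambda>\<omega>. \<phi> \<omega> *\<^sub>R \<Phi> \<omega>) \<in> Bi1 M"
  shows "is_cond_exp M F (\<lambda>\<omega>. \<phi> \<omega> *\<^sub>R \<Phi> \<omega>) (\<lambda>\<omega>. \<phi> \<omega> *\<^sub>R \<Psi> \<omega>) \<and>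
    (\<forall>\<Theta>. is_cond_exp M F (\<lambda>\<omega>. \<phi> \<omega> *\<^sub>R \<Phi> \<omega>) \<Theta> \<longrightarrow> (AE \<omega> in M. \<Theta> \<omega> = \<phi> \<omega> *\<^sub>R \<Psi> \<omega>))"
proof -
  interpret finite_measure M by fact
  note [measurable] = \<open>\<phi> \<in> borel_measurable F\<close>
  have sets_F: "E \<in> sets M" if "E \<in> sets F" for E
    using that \<open>subalgebra M F\<close> by (auto simp: subalgebra_def)
  have \<Psi>: "strongly_measurable F \<Psi>" using assms(4) by (simp add: is_cond_exp_def)
  have integrals_F: "\<exists>J. has_Bi1_integral M (\<lambda>x. indicator E x *\<^sub>R f x) J \<and>
      has_Bi1_integral M (\<lambda>x. indicator E x *\<^sub>R g x) J"
    if "is_cond_exp M F f g" "E \<in> sets F" for E and f g :: "'a \<Rightarrow> 'x"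
    using that has_Bi1_integral_on_iff_indicator[OF sets_F[OF that(2)]] unfolding is_cond_exp_def by blast
  have eq: "has_Bi1_integral M (\<lambda>x. indicator E x *\<^sub>R (\<Phi> x - \<Psi> x)) 0" if E: "E \<in> sets F" for E
  proof -
    obtain J where "has_Bi1_integral M (\<lambda>x. indicator E x *\<^sub>R \<Phi> x) J"
      "has_Bi1_integral M (\<lambda>x. indicator E x *\<^sub>R \<Psi> x) J"
      using integrals_F[OF assms(4) E] by blast
    from has_Bi1_integral_diff[OF this] show ?thesis by (simp add: scaleR_diff_right)
  qed
  have cond: "is_cond_exp M F (\<lambda>\<omega>. \<phi> \<omega> *\<^sub>R \<Phi> \<omega>) (\<lambda>\<omega>. \<phi> \<omega> *\<^sub>R \<Psi> \<omega>)"
    unfolding is_cond_exp_def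
  proof (intro conjI ballI)
    show "strongly_measurable F (\<lambda>\<omega>. \<phi> \<omega> *\<^sub>R \<Psi> \<omega>)"
      using assms(5) \<Psi> by (rule strongly_measurable_scaleR)
    obtain J where J: "has_Bi1_integral M (\<lambda>\<omega>. \<phi> \<omega> *\<^sub>R \<Phi> \<omega>) J" using assms(6) by (auto simp: Bi1_def)
    have "has_Bi1_integral M (\<lambda>\<omega>. \<phi> \<omega> *\<^sub>R \<Psi> \<omega>) J"
      by (rule has_Bi1_integral_pull_out[OF assms(2) \<Psi> eq assms(5) J])
    then show "(\<lambda>\<omega>. \<phi> \<omega> *\<^sub>R \<Psi> \<omega>) \<in> Bi1 M" by (auto simp: Bi1_def)
  next
    fix E assume E [measurable]: "E \<in> sets F"
    have "(\<lambda>x. indicator E x *\<^sub>R (\<phi> x *\<^sub>R \<Phi> x)) \<in> Bi1 M"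
      using sets_F[OF E] by (intro Bi1_mult_bounded[OF assms(6), where K = 1]) (auto simp: indicator_def)
    then obtain J where J: "has_Bi1_integral M (\<lambda>x. (indicator E x * \<phi> x) *\<^sub>R \<Phi> x) J"
      by (auto simp: Bi1_def)
    have "(\<lambda>x. indicator E x * \<phi> x) \<in> borel_measurable F" by measurable
    then have "has_Bi1_integral M (\<lambda>x. (indicator E x * \<phi> x) *\<^sub>R \<Psi> x) J"
      by (intro has_Bi1_integral_pull_out[OF assms(2) \<Psi> eq _ J])
    with J show "\<exists>J. has_Bi1_integral_on M E (\<lambda>\<omega>. \<phi> \<omega> *\<^sub>R \<Phi> \<omega>) J \<and>
        has_Bi1_integral_on M E (\<lambda>\<omega>. \<phi> \<omega> *\<^sub>R \<Psi> \<omega>) J"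
      unfolding has_Bi1_integral_on_iff_indicator[OF sets_F[OF E]] by auto
  qed (fact assms(6))
  moreover have "AE \<omega> in M. \<Theta> \<omega> = \<phi> \<omega> *\<^sub>R \<Psi> \<omega>"
    if \<Theta>: "is_cond_exp M F (\<lambda>\<omega>. \<phi> \<omega> *\<^sub>R \<Phi> \<omega>) \<Theta>" for \<Theta>
  proof -
    have "AE \<omega> in M. \<Theta> \<omega> - \<phi> \<omega> *\<^sub>R \<Psi> \<omega> = 0"
    proof (rule AE_zero_if_Bi1_integrals_zero[OF assms(2)])
      show "strongly_measurable F (\<lambda>\<omega>. \<Theta> \<omega> - \<phi> \<omega> *\<^sub>R \<Psi> \<omega>)"
        using \<Theta> cond by (intro strongly_measurable_diff) (simp_all add: is_cond_exp_def)
    next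
      fix E assume E: "E \<in> sets F"
      obtain J where J: "has_Bi1_integral M (\<lambda>x. indicator E x *\<^sub>R (\<phi> x *\<^sub>R \<Phi> x)) J"
        "has_Bi1_integral M (\<lambda>x. indicator E x *\<^sub>R \<Theta> x) J"
        using integrals_F[OF \<Theta> E] by blast
      obtain K where K: "has_Bi1_integral M (\<lambda>x. indicator E x *\<^sub>R (\<phi> x *\<^sub>R \<Phi> x)) K"
        "has_Bi1_integral M (\<lambda>x. indicator E x *\<^sub>R (\<phi> x *\<^sub>R \<Psi> x)) K"
        using integrals_F[OF cond E] by blast
      have "J = K" using J(1) K(1) by (rule has_Bi1_integral_unique)
      with has_Bi1_integral_diff[OF J(2) K(2)]
      show "has_Bi1_integral M (\<lambda>x. indicator E x *\<^sub>R (\<Theta> x - \<phi> x *\<^sub>R \<Psi> x)) 0"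
        by (simp add: scaleR_diff_right)
    qed
    then show ?thesis by simp
  qed
  ultimately show ?thesis by blast
qed

end
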